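(* For each $n\ge0$ (and $\theta\in\{0,1\}$), the discrete system of the MFEM scheme has a unique solution $(\mathbf{u}_h^{n+1},\xi_h^{n+1},\eta_h^{n+1})\in\mathbf{V}_h\times M_h\times W_h$.
   Context: Setting: $\Omega\subset\mathbb{R}^2$ bounded convex polygonal domain, $T>0$; parameters $\lambda,\mu>0$, $\alpha>0$, $c_0>0$, $\mu_f>0$, constants $\rho_f$, $\mathbf{g}$; symmetric $K(x)$ with $K_1|\zeta|^2\le K\zeta\cdot\zeta\le K_2|\zeta|^2$. $\varepsilon(\mathbf{u})=\tfrac12(\nabla\mathbf{u}+\nabla\mathbf{u}^T)$; $\sigma$ is the Hencky–Mises stress $\sigma(\mathbf{u})=\tilde\lambda(\mathrm{dev}\,\varepsilon(\mathbf{u}))\mathrm{tr}(\varepsilon(\mathbf{u}))\mathbf{I}+\tilde\mu(\mathrm{dev}\,\varepsilon(\mathbf{u}))\varepsilon(\mathbf{u})$ with $\mathrm{dev}(\tau)=\mathrm{tr}(\tau^2)-\tfrac12\mathrm{tr}^2\tau$, $\tilde\mu=2\mu\Phi'$, $\tilde\lambda=\kappa-\tfrac12\tilde\mu$ ($0<k_0\le\kappa\le k_1$, $\Phi\in C^2$, $a_1\le\mu\Phi'<\kappa$, $|\rho\Phi''|\le a_2$, $\Phi'+2\rho\Phi''\ge a_3$); $\mathcal{N}(\varepsilon(\mathbf{u}))=\sigma(\mathbf{u})-\lambda^{-1}(\mathrm{div}\,\mathbf{u})\mathbf{I}$, assumed strongly monotone and Lipschitz in $\varepsilon$ (which holds when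 $\lambda>2/C_3$, $C_3$ the monotonicity constant of $\sigma$); $\kappa_1=\frac{\lambda\alpha}{\lambda\alpha^2+c_0}$, $\kappa_2=\frac1{\lambda\alpha^2+c_0}$, $\kappa_3=\frac{\lambda c_0}{\lambda\alpha^2+c_0}$. Data $\mathbf{f}\in L^2(\Omega)^2,\mathbf{f}_1\in L^2(\partial\Omega)^2,\phi\in L^2(\Omega),\phi_1\in L^2(\partial\Omega)$. $\mathbf{RM}$ = rigid motions $\{\mathbf{a}+b(-x_2,x_1)^T\}$. Discretization: $\mathcal{T}_h$ quasi-uniform triangulation; $\mathbf{X}_h$ = continuous piecewise quadratic vector fields; $\mathbf{V}_h=\{\mathbf{v}_h\in\mathbf{X}_h:(\mathbf{v}_h,\mathbf{r})=0\ \forall\mathbf{r}\in\mathbf{RM}\}$; $M_h=W_h$ = continuous piecewise linears. $\Delta t=T/N$, $t_n=n\Delta t$, $d_tw^{n+1}=(w^{n+1}-w^n)/\Delta t$. Given $(\mathbf{u}_h^n,\xi_h^n,\eta_h^n)$ (and $\eta_h^{n-1}$ when $\theta=0$), the MFEM step seeks $(\mathbf{u}_h^{n+1},\xi_h^{n+1},\eta_h^{n+1})$ with $(\mathcal{N}(\varepsilon(\mathbf{u}_h^{n+1})),\varepsilon(\mathbf{v}_h))-(\xi_h^{n+1},\mathrm{div}\,\mathbf{v}_h)=(\mathbf{f}(t_{n+1}),\mathbf{v}_h)+\langle\mathbf{f}_1(t_{n+1}),\mathbf{v}_h\rangle$ $\forall\mathbf{v}_h\in\mathbf{V}_h$; $\kappa_3(\xi_h^{n+1},\varphi_h)+(\mathrm{div}\,\mathbf{u}_h^{n+1},\varphi_h)=\kappa_1(\eta_h^{n+\theta},\varphi_h)$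 $\forall\varphi_h\in M_h$; $(d_t\eta_h^{n+1},\psi_h)+\frac1{\mu_f}(K(\nabla(\kappa_1\xi_h^{n+1}+\kappa_2\eta_h^{n+1})-\rho_f\mathbf{g}),\nabla\psi_h)=(\phi,\psi_h)+\langle\phi_1,\psi_h\rangle$ $\forall\psi_h\in M_h$. *)

theory Defs
  imports "HOL-Analysis.Analysis"
begin

definition convex_polygonal_domain :: "(real^2) set \<Rightarrow> bool" where
  "convex_polygonal_domain \<Omega> \<longleftrightarrow>
     \<Omega> \<noteq> {} \<and> (\<exists>P. finite P \<and> \<Omega> = interior (convex hull P))"

text \<open>Sides of the polygon: maximal nondegenerate segments contained in the boundary
  (stored as ordered pairs, so each side occurs twice).\<close>
definition polygon_sides :: "(real^2) set \<Rightarrow> ((real^2) \<times> (real^2)) set" where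
  "polygon_sides \<Omega> = {(a,b). a \<noteq> b \<and> closed_segment a b \<subseteq> frontier \<Omega> \<and>
      (\<forall>c d. closed_segment a b \<subseteq> closed_segment c d \<and> closed_segment c d \<subseteq> frontier \<Omega>
             \<longrightarrow> {c,d} = {a,b})}"

definition bdry_int :: "(real^2) set \<Rightarrow> (real^2 \<Rightarrow> real) \<Rightarrow> real" where
  "bdry_int \<Omega> h = (\<Sum>(a,b)\<in>polygon_sides \<Omega>.
       dist a b * integral\<^sup>L (lebesgue_on {0..1}) (\<lambda>t. h (a + t *\<^sub>R (b - a)))) / 2"

definition dom_int :: "(real^2) set \<Rightarrow> (real^2 \<Rightarrow> real) \<Rightarrow> real" where
  "dom_int \<Omega> h = integral\<^sup>L (lebesgue_on \<Omega>) h"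

definition L2_dom :: "(real^2) set \<Rightarrow> (real^2 \<Rightarrow> 'b::euclidean_space) \<Rightarrow> bool" where
  "L2_dom \<Omega> h \<longleftrightarrow> h \<in> borel_measurable (lebesgue_on \<Omega>) \<and>
       integrable (lebesgue_on \<Omega>) (\<lambda>x. (norm (h x))\<^sup>2)"

definition L2_bdry :: "(real^2) set \<Rightarrow> (real^2 \<Rightarrow> 'b::euclidean_space) \<Rightarrow> bool" where
  "L2_bdry \<Omega> h \<longleftrightarrow> (\<forall>a b. closed_segment a b \<subseteq> frontier \<Omega> \<longrightarrow>
       (\<lambda>t. h (a + t *\<^sub>R (b - a))) \<in> borel_measurable (lebesgue_on {0..1}) \<and>
       integrable (lebesgue_on {0..1}) (\<lambda>t. (norm (h (a + t *\<^sub>R (b - a))))\<^sup>2))"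

definition triangle_verts :: "(real^2) set \<Rightarrow> bool" where
  "triangle_verts V \<longleftrightarrow> card V = 3 \<and> \<not> affine_dependent V"

definition conforming_triangulation :: "(real^2) set set \<Rightarrow> (real^2) set \<Rightarrow> bool" where
  "conforming_triangulation Tr D \<longleftrightarrow> finite Tr \<and> Tr \<noteq> {} \<and>
     (\<forall>V\<in>Tr. triangle_verts V) \<and>
     \<Union>((\<lambda>V. convex hull V) ` Tr) = D \<and>
     (\<forall>V\<in>Tr. \<forall>W\<in>Tr. V \<noteq> W \<longrightarrow> (convex hull V) \<inter> (convex hull W) = convex hull (V \<inter> W))"

definition quasi_uniform_family ::
  "real set \<Rightarrow> (real \<Rightarrow> (real^2) set set) \<Rightarrow> (real^2) set \<Rightarrow> bool" where
  "quasi_uniform_family Hs Th D \<longleftrightarrow>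
     (\<forall>h\<in>Hs. h > 0 \<and> conforming_triangulation (Th h) D \<and>
        (\<forall>V\<in>Th h. diameter (convex hull V) \<le> h)) \<and>
     (\<exists>c>0. \<forall>h\<in>Hs. \<forall>V\<in>Th h. \<exists>x. ball x (c * h) \<subseteq> convex hull V)"

definition poly_deg_le_on :: "nat \<Rightarrow> (real^2) set \<Rightarrow> (real^2 \<Rightarrow> real) \<Rightarrow> bool" where
  "poly_deg_le_on k S p \<longleftrightarrow> (\<exists>c::nat \<Rightarrow> nat \<Rightarrow> real. \<forall>x\<in>S.
      p x = (\<Sum>i\<le>k. \<Sum>j\<le>k - i. c i j * (x$1)^i * (x$2)^j))"

definition Lagrange_space :: "nat \<Rightarrow> (real^2) set set \<Rightarrow> (real^2) set \<Rightarrow> (real^2 \<Rightarrow> real) set" where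
  "Lagrange_space k Tr D = {p. continuous_on D p \<and> (\<forall>x. x \<notin> D \<longrightarrow> p x = 0) \<and>
      (\<forall>V\<in>Tr. poly_deg_le_on k (convex hull V) p)}"

definition X_h :: "(real^2) set set \<Rightarrow> (real^2) set \<Rightarrow> (real^2 \<Rightarrow> real^2) set" where
  "X_h Tr \<Omega> = {v. \<forall>i. (\<lambda>x. v x $ i) \<in> Lagrange_space 2 Tr (closure \<Omega>)}"

definition rigid_motion :: "real^2 \<Rightarrow> real \<Rightarrow> real^2 \<Rightarrow> real^2" where
  "rigid_motion a b x = a + b *\<^sub>R (\<chi> i. if i = 1 then - (x$2) else x$1)"

definition V_h :: "(real^2) set set \<Rightarrow> (real^2) set \<Rightarrow> (real^2 \<Rightarrow> real^2) set" where
  "V_h Tr \<Omega> = {v \<in> X_h Tr \<Omega>. \<forall>a b. dom_int \<Omega> (\<lambda>x. v x \<bullet> rigid_motion a b x) = 0}"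

text \<open>\<open>M_h = W_h\<close>: continuous piecewise linears.\<close>
definition M_h :: "(real^2) set set \<Rightarrow> (real^2) set \<Rightarrow> (real^2 \<Rightarrow> real) set" where
  "M_h Tr \<Omega> = Lagrange_space 1 Tr (closure \<Omega>)"

text \<open>Jacobian \<open>(\<nabla>v)\<^sub>i\<^sub>j = \<partial>v\<^sub>i/\<partial>x\<^sub>j\<close> (defined a.e. for piecewise polynomials).\<close>
definition jac :: "(real^2 \<Rightarrow> real^2) \<Rightarrow> real^2 \<Rightarrow> real^2^2" where
  "jac v x = (\<chi> i j. (frechet_derivative v (at x) (axis j 1)) $ i)"

definition grad :: "(real^2 \<Rightarrow> real) \<Rightarrow> real^2 \<Rightarrow> real^2" where
  "grad p x = (\<chi> j. frechet_derivative p (at x) (axis j 1))"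

definition strain :: "(real^2 \<Rightarrow> real^2) \<Rightarrow> real^2 \<Rightarrow> real^2^2" where
  "strain v x = (1/2) *\<^sub>R (jac v x + transpose (jac v x))"

definition divg :: "(real^2 \<Rightarrow> real^2) \<Rightarrow> real^2 \<Rightarrow> real" where
  "divg v x = trace (jac v x)"

definition dev :: "real^2^2 \<Rightarrow> real" where
  "dev \<tau> = trace (\<tau> ** \<tau>) - (1/2) * (trace \<tau>)\<^sup>2"

text \<open>Hencky--Mises stress with \<open>\<mu>~ = 2\<mu>\<Phi>'\<close>, \<open>\<lambda>~ = \<kappa> - \<mu>~/2\<close>.\<close>
definition sigma_HM :: "real \<Rightarrow> real \<Rightarrow> (real \<Rightarrow> real) \<Rightarrow> real^2^2 \<Rightarrow> real^2^2" where
  "sigma_HM \<kappa> \<mu> \<Phi> e =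
     (let mt = 2 * \<mu> * deriv \<Phi> (dev e); lt = \<kappa> - mt / 2
      in (lt * trace e) *\<^sub>R mat 1 + mt *\<^sub>R e)"

definition N_op :: "real \<Rightarrow> real \<Rightarrow> real \<Rightarrow> (real \<Rightarrow> real) \<Rightarrow> real^2^2 \<Rightarrow> real^2^2" where
  "N_op lam \<kappa> \<mu> \<Phi> e = sigma_HM \<kappa> \<mu> \<Phi> e - (trace e / lam) *\<^sub>R mat 1"

definition kappa1 :: "real \<Rightarrow> real \<Rightarrow> real \<Rightarrow> real" where
  "kappa1 lam \<alpha> c0 = lam * \<alpha> / (lam * \<alpha>\<^sup>2 + c0)"
definition kappa2 :: "real \<Rightarrow> real \<Rightarrow> real \<Rightarrow> real" where
  "kappa2 lam \<alpha> c0 = 1 / (lam * \<alpha>\<^sup>2 + c0)"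
definition kappa3 :: "real \<Rightarrow> real \<Rightarrow> real \<Rightarrow> real" where
  "kappa3 lam \<alpha> c0 = lam * c0 / (lam * \<alpha>\<^sup>2 + c0)"

text \<open>Equations of the step \<open>n \<rightarrow> n+1\<close> for unknowns \<open>(u, \<xi>, \<eta>)\<close>; \<open>\<eta>n\<close> is \<open>\<eta>\<^sub>h\<^sup>n\<close>,
  \<open>tn1\<close> is \<open>t\<^sub>n\<^sub>+\<^sub>1\<close>, and \<open>\<eta>\<^sub>h\<^sup>n\<^sup>+\<^sup>\<theta>\<close> is \<open>\<eta>n\<close> if \<open>\<theta> = 0\<close> and \<open>\<eta>\<close> if \<open>\<theta> = 1\<close>.\<close>
definition mfem_step ::
  "(real^2) set set \<Rightarrow> (real^2) set \<Rightarrow> real \<Rightarrow> real \<Rightarrow> real \<Rightarrow> (real \<Rightarrow> real) \<Rightarrow>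
   real \<Rightarrow> real \<Rightarrow> real \<Rightarrow> real \<Rightarrow> real^2 \<Rightarrow> (real^2 \<Rightarrow> real^2^2) \<Rightarrow>
   (real \<Rightarrow> real^2 \<Rightarrow> real^2) \<Rightarrow> (real \<Rightarrow> real^2 \<Rightarrow> real^2) \<Rightarrow>
   (real^2 \<Rightarrow> real) \<Rightarrow> (real^2 \<Rightarrow> real) \<Rightarrow> nat \<Rightarrow> real \<Rightarrow> real \<Rightarrow>
   (real^2 \<Rightarrow> real) \<Rightarrow>
   (real^2 \<Rightarrow> real^2) \<Rightarrow> (real^2 \<Rightarrow> real) \<Rightarrow> (real^2 \<Rightarrow> real) \<Rightarrow> bool" where
  "mfem_step Tr \<Omega> lam \<kappa> \<mu> \<Phi> \<alpha> c0 \<mu>f \<rho>f g K f f1 \<phi> \<phi>1 \<theta> dt tn1 \<eta>n u \<xi> \<eta> \<longleftrightarrow>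
     (let k1 = kappa1 lam \<alpha> c0; k2 = kappa2 lam \<alpha> c0; k3 = kappa3 lam \<alpha> c0;
          \<eta>\<theta> = (if \<theta> = 0 then \<eta>n else \<eta>) in
     (\<forall>v\<in>V_h Tr \<Omega>.
        dom_int \<Omega> (\<lambda>x. N_op lam \<kappa> \<mu> \<Phi> (strain u x) \<bullet> strain v x)
        - dom_int \<Omega> (\<lambda>x. \<xi> x * divg v x)
        = dom_int \<Omega> (\<lambda>x. f tn1 x \<bullet> v x) + bdry_int \<Omega> (\<lambda>x. f1 tn1 x \<bullet> v x)) \<and>
     (\<forall>\<psi>\<in>M_h Tr \<Omega>.
        k3 * dom_int \<Omega> (\<lambda>x. \<xi> x * \<psi> x) + dom_int \<Omega> (\<lambda>x. divg u x * \<psi> x)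
        = k1 * dom_int \<Omega> (\<lambda>x. \<eta>\<theta> x * \<psi> x)) \<and>
     (\<forall>\<psi>\<in>M_h Tr \<Omega>.
        dom_int \<Omega> (\<lambda>x. ((\<eta> x - \<eta>n x) / dt) * \<psi> x)
        + (1 / \<mu>f) * dom_int \<Omega> (\<lambda>x. (K x *v (grad (\<lambda>y. k1 * \<xi> y + k2 * \<eta> y) x - \<rho>f *\<^sub>R g))
                                       \<bullet> grad \<psi> x)
        = dom_int \<Omega> (\<lambda>x. \<phi> x * \<psi> x) + bdry_int \<Omega> (\<lambda>x. \<phi>1 x * \<psi> x)))"

end

theory Submission
  imports Defs "HOL-Library.Function_Algebras"
begin

text \<open>In the unknowns \<open>(u, \<xi>, p)\<close> with \<open>p = \<kappa>\<^sub>1 \<xi> + \<kappa>\<^sub>2 \<eta>\<close> one step of the scheme, with the third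
  equation multiplied by a weight \<open>\<delta> > 0\<close>, has the form
  \<open>\<integral> a(x, D z) \<bullet> D w = l(w)\<close> with \<open>D (u, \<xi>, p) = (\<epsilon>(u), \<xi>, p, \<nabla>p)\<close>, where \<open>a(x, \<cdot>)\<close> is pointwise strongly
  monotone and Lipschitz: the terms \<open>\<xi> div v\<close> cancel, and the couplings of \<open>\<xi>\<close> and \<open>p\<close> form a positive
  definite quadratic form. Since \<open>\<integral> D z \<bullet> D w\<close> is an inner product on the finite-dimensional discrete space,
  the contraction argument of Zarantonello gives existence and uniqueness. Definiteness is Korn's
  statement that \<open>\<epsilon>(u) = 0\<close> forces \<open>u\<close> to be a rigid motion: the increments satisfy
  \<open>(u(x) - u(y)) \<bullet> (x - y) = 0\<close> first on each triangle and then, along segments, on the whole convex domain.\<close>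

section \<open>Strongly monotone problems in finite dimension\<close>

text \<open>The obstacle is the flow equation. Tested with \<open>\<eta>\<close>, it produces the
  mixed term \<open>K \<nabla>\<xi> \<bullet> \<nabla>\<eta>\<close>, which has no sign. In the
  unknown \<open>p\<close> the diffusion term becomes
  \<open>K \<nabla>p \<bullet> \<nabla>p\<close>, and the coupling survives only in the zero-order
  expression \<open>(p - \<kappa>\<^sub>1 \<xi>) / \<kappa>\<^sub>2\<close>; coercivity is then a
  question about a quadratic form in two real numbers, where \<open>\<kappa>\<^sub>3\<close>
  supplies the square of \<open>\<xi>\<close>. Since \<open>\<xi>\<close> and \<open>\<eta>\<close>
  range over the same space, the substitution is a bijection of the discrete space. Two restrictions
  shape the general results. Monotonicity of \<open>N_op\<close> is given at symmetric matrices
  only, so the pointwise estimates are confined to a set of admissible values. Derivatives of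
  discrete functions may be unspecified on the mesh edges, so linearity and boundedness of
  \<open>D\<close> are almost everywhere statements.\<close>

instantiation "fun" :: (type, real_vector) real_vector
begin

text \<open>With this instance \<open>subspace\<close>, \<open>span\<close> and
  \<open>linear\<close> apply directly to the sets of discrete functions.\<close>

definition "scaleR c f = (\<lambda>x. c *\<^sub>R f x)"

instance
  by standard (auto simp: scaleR_fun_def fun_eq_iff scaleR_add_left scaleR_add_right)

end

lemma scaleR_fun_apply [simp]: "(c *\<^sub>R f) x = c *\<^sub>R f x"
  by (simp add: scaleR_fun_def)

lemma sum_fun_apply: "(\<Sum>i\<in>A. f i) x = (\<Sum>i\<in>A. f i x)"
  by (induction A rule: infinite_finite_induct) auto

text \<open>The form is a parameter on a carrier rather than a class instance: the one used later
  measures displacements by their strains, so it is definite only where rigid motions have been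
  removed.\<close>

locale finite_dim_inner =
  fixes Z :: "'z::real_vector set" and ip :: "'z \<Rightarrow> 'z \<Rightarrow> real" and G :: "'z set"
  assumes sub: "subspace Z"
    and fin: "finite G" "Z \<subseteq> span G"
    and ip_commute: "\<lbrakk>x \<in> Z; y \<in> Z\<rbrakk> \<Longrightarrow> ip x y = ip y x"
    and ip_add: "\<lbrakk>x \<in> Z; y \<in> Z; w \<in> Z\<rbrakk> \<Longrightarrow> ip (x + y) w = ip x w + ip y w"
    and ip_scale: "\<lbrakk>x \<in> Z; w \<in> Z\<rbrakk> \<Longrightarrow> ip (c *\<^sub>R x) w = c * ip x w"
    and ip_nonneg: "x \<in> Z \<Longrightarrow> 0 \<le> ip x x"
    and ip_zero: "\<lbrakk>x \<in> Z; ip x x = 0\<rbrakk> \<Longrightarrow> x = 0"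
begin

definition "orthonormal E \<longleftrightarrow>
  finite E \<and> E \<subseteq> Z \<and> (\<forall>e\<in>E. \<forall>e'\<in>E. ip e e' = (if e = e' then 1 else 0))"

lemma ip_zero_left: "w \<in> Z \<Longrightarrow> ip 0 w = 0"
  using ip_scale[of w w 0] by simp

lemma sum_in: "finite E \<Longrightarrow> E \<subseteq> Z \<Longrightarrow> (\<Sum>e\<in>E. c e *\<^sub>R e) \<in> Z"
  by (intro subspace_sum[OF sub] subspace_scale[OF sub]) auto

lemma ip_sum:
  assumes "finite E" "E \<subseteq> Z" "w \<in> Z"
  shows "ip (\<Sum>e\<in>E. c e *\<^sub>R e) w = (\<Sum>e\<in>E. c e * ip e w)"
  using assms
proof (induction E rule: finite_induct)
  case empty
  then show ?case by (simp add: ip_zero_left)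
next
  case (insert e E)
  then show ?case
    by (simp add: ip_add ip_scale sum_in subspace_scale[OF sub])
qed

lemma ip_diff: "\<lbrakk>x \<in> Z; y \<in> Z; w \<in> Z\<rbrakk> \<Longrightarrow> ip (x - y) w = ip x w - ip y w"
  using ip_add[of "x - y" y w] subspace_diff[OF sub] by fastforce

lemma ip_sum_orthonormal:
  assumes "orthonormal E" "e \<in> E"
  shows "ip (\<Sum>e\<in>E. c e *\<^sub>R e) e = c e"
proof -
  have "ip (\<Sum>e\<in>E. c e *\<^sub>R e) e = (\<Sum>e'\<in>E. c e' * ip e' e)"
    using assms by (intro ip_sum) (auto simp: orthonormal_def)
  also have "\<dots> = (\<Sum>e'\<in>E. if e' = e then c e' else 0)"
    using assms by (intro sum.cong) (auto simp: orthonormal_def)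
  also have "\<dots> = c e"
    using assms by (simp add: orthonormal_def)
  finally show ?thesis .
qed

text \<open>Pairing a linear combination with a member of \<open>E\<close> returns its coefficient,
  hence independence. The bound guarantees that a largest orthonormal set exists.\<close>

lemma orthonormal_card_le:
  assumes "orthonormal E"
  shows "card E \<le> card G"
proof -
  have "independent E"
  proof (rule independent_if_scalars_zero)
    show "finite E" using assms by (simp add: orthonormal_def)
    fix c e assume "(\<Sum>e\<in>E. c e *\<^sub>R e) = 0" "e \<in> E"
    then show "c e = 0"
      using ip_sum_orthonormal[OF assms, of e c] ip_zero_left[of e] assms
      by (auto simp: orthonormal_def)
  qed
  moreover have "E \<subseteq> span G"
    using assms fin by (auto simp: orthonormal_def)
  ultimately show ?thesis
    using independent_span_bound[OF fin(1)] by blast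
qed

text \<open>One Gram-Schmidt step: the residual \<open>r\<close> of a vector that differs from its
  projection is orthogonal to \<open>E\<close> and, by definiteness, can be normalised.\<close>

lemma orthonormal_insert:
  assumes E: "orthonormal E" and x: "x \<in> Z" and ne: "x \<noteq> (\<Sum>e\<in>E. ip x e *\<^sub>R e)"
  shows "\<exists>y. y \<notin> E \<and> orthonormal (insert y E)"
proof -
  have EZ: "finite E" "E \<subseteq> Z" using E by (auto simp: orthonormal_def)
  define r where "r = x - (\<Sum>e\<in>E. ip x e *\<^sub>R e)"
  have r: "r \<in> Z" unfolding r_def by (intro subspace_diff[OF sub] x sum_in EZ)
  have rE: "ip r e = 0" if "e \<in> E" for e
    unfolding r_def using that EZ x by (subst ip_diff) (auto simp: ip_sum_orthonormal[OF E] sum_in)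
  have "ip r r \<noteq> 0" using ip_zero[OF r] ne by (auto simp: r_def)
  then have pos: "ip r r > 0" using ip_nonneg[OF r] by simp
  define y where "y = (1 / sqrt (ip r r)) *\<^sub>R r"
  have y: "y \<in> Z" unfolding y_def by (intro subspace_scale[OF sub] r)
  have yE: "ip y e = 0" "ip e y = 0" if "e \<in> E" for e
  proof -
    show "ip y e = 0" using that EZ r rE unfolding y_def by (subst ip_scale) auto
    then show "ip e y = 0" using ip_commute[of e y] that EZ y by auto
  qed
  have "ip y y = (1 / sqrt (ip r r)) * ip r y"
    using ip_scale[OF r y] by (simp add: y_def)
  also have "ip r y = (1 / sqrt (ip r r)) * ip r r"
    using ip_commute[OF r y] ip_scale[OF r r] by (simp add: y_def)
  also have "(1 / sqrt (ip r r)) * \<dots> = 1" using pos by (simp add: field_simps)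
  finally have yy: "ip y y = 1" .
  then have "y \<notin> E" using yE by force
  moreover have "orthonormal (insert y E)"
    using E y yE yy \<open>y \<notin> E\<close> unfolding orthonormal_def by auto
  ultimately show ?thesis by blast
qed

text \<open>In an orthonormal set of greatest cardinality every vector is recovered from its
  coefficients, since otherwise the set could be enlarged.\<close>

lemma orthonormal_basis: "\<exists>E. orthonormal E \<and> (\<forall>x\<in>Z. x = (\<Sum>e\<in>E. ip x e *\<^sub>R e))"
proof -
  have "orthonormal {}" by (simp add: orthonormal_def)
  then obtain E where E: "orthonormal E" "\<And>E'. orthonormal E' \<Longrightarrow> card E' \<le> card E"
    using ex_has_greatest_nat[of orthonormal "{}" card "Suc (card G)"] orthonormal_card_le
    by (auto simp: less_Suc_eq_le)
  have "x = (\<Sum>e\<in>E. ip x e *\<^sub>R e)" if "x \<in> Z" for x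
  proof (rule ccontr)
    assume "x \<noteq> (\<Sum>e\<in>E. ip x e *\<^sub>R e)"
    then obtain y where "y \<notin> E" "orthonormal (insert y E)"
      using orthonormal_insert[OF E(1) \<open>x \<in> Z\<close>] by blast
    then show False using E(2)[of "insert y E"] E(1) by (simp add: orthonormal_def)
  qed
  then show ?thesis using E by blast
qed

text \<open>Zarantonello: for small \<open>\<rho>\<close> the map \<open>x \<mapsto> x - \<rho> R (A x)\<close>, with \<open>R\<close> the Riesz map, is a contraction.
  The bound \<open>lip\<close> is a form of Lipschitz continuity that needs no Cauchy--Schwarz inequality.\<close>

theorem strongly_monotone_unique_zero:
  fixes A :: "'z \<Rightarrow> 'z \<Rightarrow> real"
  assumes A_add: "\<And>x v w. \<lbrakk>x \<in> Z; v \<in> Z; w \<in> Z\<rbrakk> \<Longrightarrow> A x (v + w) = A x v + A x w"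
    and A_scale: "\<And>x v c. \<lbrakk>x \<in> Z; v \<in> Z\<rbrakk> \<Longrightarrow> A x (c *\<^sub>R v) = c * A x v"
    and \<gamma>: "\<gamma> > 0"
    and mono: "\<And>x y. \<lbrakk>x \<in> Z; y \<in> Z\<rbrakk> \<Longrightarrow> A x (x - y) - A y (x - y) \<ge> \<gamma> * ip (x - y) (x - y)"
    and lip: "\<And>x y v. \<lbrakk>x \<in> Z; y \<in> Z; v \<in> Z\<rbrakk> \<Longrightarrow>
      2 * (A x v - A y v) \<le> L\<^sup>2 * ip (x - y) (x - y) + ip v v"
  shows "\<exists>!x. x \<in> Z \<and> (\<forall>v\<in>Z. A x v = 0)"
proof -
  obtain E where on: "orthonormal E" and basis: "\<And>x. x \<in> Z \<Longrightarrow> x = (\<Sum>e\<in>E. ip x e *\<^sub>R e)"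
    using orthonormal_basis by blast
  have E: "finite E" "E \<subseteq> Z" using on by (auto simp: orthonormal_def)
  have diffZ: "x - y \<in> Z" if "x \<in> Z" "y \<in> Z" for x y using subspace_diff[OF sub that] .
  have parseval: "ip x x = (\<Sum>e\<in>E. (ip x e)\<^sup>2)" if "x \<in> Z" for x
  proof -
    have "ip x x = ip (\<Sum>e\<in>E. ip x e *\<^sub>R e) x" using basis[OF that] by simp
    also have "\<dots> = (\<Sum>e\<in>E. ip x e * ip e x)" by (rule ip_sum) (use E that in auto)
    also have "\<dots> = (\<Sum>e\<in>E. (ip x e)\<^sup>2)"
      using E that by (intro sum.cong) (auto simp: power2_eq_square ip_commute[of x])
    finally show ?thesis .
  qed
  have A_sum: "A x (\<Sum>e\<in>F. c e *\<^sub>R e) = (\<Sum>e\<in>F. c e * A x e)" if "x \<in> Z" "F \<subseteq> E" for x c F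
    using finite_subset[OF that(2) E(1)] that(2)
  proof (induction F rule: finite_induct)
    case empty
    show ?case using A_scale[OF that(1) that(1), of 0] by simp
  next
    case (insert e F)
    then have "F \<subseteq> Z" "e \<in> Z" using E by auto
    with insert that(1) show ?case
      by (simp add: A_add A_scale sum_in subspace_scale[OF sub])
  qed

  \<comment> \<open>Distance is measured in coordinates with respect to \<open>E\<close>: the
    triangle inequality comes from \<open>L2_set\<close>, and completeness reduces to that of the
    reals. \<open>d2\<close> identifies \<open>d\<close> with the norm of the form.\<close>
  define d where "d x y = L2_set (\<lambda>e. ip x e - ip y e) E" for x y
  have d2: "(d x y)\<^sup>2 = ip (x - y) (x - y)" if "x \<in> Z" "y \<in> Z" for x y
  proof -
    have "(d x y)\<^sup>2 = (\<Sum>e\<in>E. (ip x e - ip y e)\<^sup>2)"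
      by (simp add: d_def L2_set_def sum_nonneg)
    also have "\<dots> = (\<Sum>e\<in>E. (ip (x - y) e)\<^sup>2)"
      using that E by (intro sum.cong) (auto simp: ip_diff)
    also have "\<dots> = ip (x - y) (x - y)" using parseval[OF diffZ[OF that]] by simp
    finally show ?thesis .
  qed
  interpret Metric_space Z d
  proof
    show "0 \<le> d x y" for x y by (simp add: d_def L2_set_nonneg)
    show "d x y = d y x" for x y by (simp add: d_def L2_set_def power2_commute)
    show "d x y = 0 \<longleftrightarrow> x = y" if "x \<in> Z" "y \<in> Z" for x y
      using d2[OF that] ip_zero[OF diffZ[OF that]] ip_zero_left[OF subspace_0[OF sub]] by auto
    show "d x z \<le> d x y + d y z" for x y z
      using L2_set_triangle_ineq[of "\<lambda>e. ip x e - ip y e" "\<lambda>e. ip y e - ip z e" E]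
      by (simp add: d_def)
  qed
  have mcomplete
    unfolding mcomplete_def
  proof (intro allI impI)
    fix s assume s: "MCauchy s"
    then have sZ: "s n \<in> Z" for n by (auto simp: MCauchy_def)
    have "\<exists>l. (\<lambda>n. ip (s n) e) \<longlonglongrightarrow> l" if "e \<in> E" for e
    proof -
      have "Cauchy (\<lambda>n. ip (s n) e)"
        unfolding Cauchy_def
      proof (intro allI impI)
        fix r :: real assume "r > 0"
        then obtain N where N: "\<And>m n. N \<le> m \<Longrightarrow> N \<le> n \<Longrightarrow> d (s m) (s n) < r"
          using s unfolding MCauchy_def by meson
        have "dist (ip (s m) e) (ip (s n) e) \<le> d (s m) (s n)" for m n
        proof -
          have "L2_set (\<lambda>e. \<bar>ip (s m) e - ip (s n) e\<bar>) E = d (s m) (s n)"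
            by (simp add: d_def L2_set_def)
          then show ?thesis
            using member_le_L2_set[OF E(1) that, of "\<lambda>e. \<bar>ip (s m) e - ip (s n) e\<bar>"]
            by (simp add: dist_real_def)
        qed
        then show "\<exists>N. \<forall>m\<ge>N. \<forall>n\<ge>N. dist (ip (s m) e) (ip (s n) e) < r"
          using N by (meson le_less_trans)
      qed
      then show ?thesis by (simp add: Cauchy_convergent_iff convergent_def)
    qed
    then obtain l where l: "\<And>e. e \<in> E \<Longrightarrow> (\<lambda>n. ip (s n) e) \<longlonglongrightarrow> l e" by metis
    define x where "x = (\<Sum>e\<in>E. l e *\<^sub>R e)"
    have x: "x \<in> Z" unfolding x_def by (intro sum_in E)
    have "(\<lambda>n. d (s n) x) \<longlonglongrightarrow> sqrt (\<Sum>e\<in>E. (l e - l e)\<^sup>2)"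
      unfolding d_def L2_set_def x_def
      by (intro tendsto_intros) (simp_all add: ip_sum_orthonormal[OF on] l)
    then have "limitin mtopology s x sequentially"
      using x sZ by (simp add: limitin_metric_dist_null)
    then show "\<exists>x. limitin mtopology s x sequentially" ..
  qed

  \<comment> \<open>A Lipschitz bound that is positive and dominates \<open>\<gamma>\<close>, so
    that \<open>1 - \<gamma>^2 / M^2\<close> below is nonnegative and less than 1 whatever
    \<open>L\<close> is.\<close>
  define M where "M = max \<bar>L\<bar> \<gamma>"
  have M: "M > 0" "\<gamma> \<le> M" "L\<^sup>2 \<le> M\<^sup>2"
    using \<gamma> by (auto simp: M_def abs_le_square_iff[symmetric])
  have A_lip: "(\<Sum>e\<in>E. (A x e - A y e)\<^sup>2) \<le> M\<^sup>2 * (d x y)\<^sup>2" if "x \<in> Z" "y \<in> Z" for x y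
  proof -
    define D where "D e = A x e - A y e" for e
    \<comment> \<open>The Riesz representative of \<open>A x - A y\<close>: the pairing with it and
      \<open>ip v v\<close> are the same sum, so the factor 2 in \<open>lip\<close> leaves one copy
      on the left.\<close>
    define v where "v = (\<Sum>e\<in>E. D e *\<^sub>R e)"
    have v: "v \<in> Z" unfolding v_def by (intro sum_in E)
    have "A x v - A y v = (\<Sum>e\<in>E. D e * A x e) - (\<Sum>e\<in>E. D e * A y e)"
      unfolding v_def using that by (simp add: A_sum)
    also have "\<dots> = (\<Sum>e\<in>E. (D e)\<^sup>2)"
      by (simp add: sum_subtractf[symmetric] D_def power2_eq_square algebra_simps)
    finally have "A x v - A y v = (\<Sum>e\<in>E. (D e)\<^sup>2)" .
    moreover have "ip v v = (\<Sum>e\<in>E. (D e)\<^sup>2)"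
      unfolding parseval[OF v] by (simp add: v_def ip_sum_orthonormal[OF on])
    ultimately have "(\<Sum>e\<in>E. (D e)\<^sup>2) \<le> L\<^sup>2 * (d x y)\<^sup>2"
      using lip[OF that v] d2[OF that] by simp
    also have "\<dots> \<le> M\<^sup>2 * (d x y)\<^sup>2" using M by (intro mult_right_mono) auto
    finally show ?thesis by (simp add: D_def)
  qed
  have A_mono: "(\<Sum>e\<in>E. (ip x e - ip y e) * (A x e - A y e)) \<ge> \<gamma> * (d x y)\<^sup>2"
    if "x \<in> Z" "y \<in> Z" for x y
  proof -
    have "A z (x - y) = (\<Sum>e\<in>E. (ip x e - ip y e) * A z e)" if "z \<in> Z" for z
    proof -
      have "A z (x - y) = A z (\<Sum>e\<in>E. ip (x - y) e *\<^sub>R e)"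
        using basis[OF diffZ[OF \<open>x \<in> Z\<close> \<open>y \<in> Z\<close>]] by simp
      also have "\<dots> = (\<Sum>e\<in>E. ip (x - y) e * A z e)" using that by (simp add: A_sum)
      also have "\<dots> = (\<Sum>e\<in>E. (ip x e - ip y e) * A z e)"
        using E \<open>x \<in> Z\<close> \<open>y \<in> Z\<close> by (intro sum.cong) (auto simp: ip_diff)
      finally show ?thesis .
    qed
    then show ?thesis
      using mono[OF that] that by (simp add: d2 sum_subtractf[symmetric] algebra_simps)
  qed
  \<comment> \<open>Expanding the square gives the factor
    \<open>1 - 2 * \<rho> * \<gamma> + \<rho>^2 * M^2\<close>. This \<open>\<rho>\<close> minimises
    it, with minimum \<open>1 - \<gamma>^2 / M^2\<close>.\<close>
  define \<rho> where "\<rho> = \<gamma> / M\<^sup>2"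
  define S where "S x = x - (\<Sum>e\<in>E. (\<rho> * A x e) *\<^sub>R e)" for x
  have S: "S x \<in> Z" if "x \<in> Z" for x unfolding S_def by (intro diffZ that sum_in E)
  have ipS: "ip (S x) e = ip x e - \<rho> * A x e" if "x \<in> Z" "e \<in> E" for x e
    unfolding S_def using that E by (subst ip_diff) (auto simp: ip_sum_orthonormal[OF on] sum_in)
  define q where "q = sqrt (1 - \<gamma>\<^sup>2 / M\<^sup>2)"
  have "\<gamma>\<^sup>2 / M\<^sup>2 \<le> 1" "\<gamma>\<^sup>2 / M\<^sup>2 > 0"
    using M \<gamma> by (auto simp: divide_le_eq power_mono)
  then have q: "q < 1" "q\<^sup>2 = 1 - \<gamma>\<^sup>2 / M\<^sup>2" "q \<ge> 0" by (auto simp: q_def)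
  have contr: "d (S x) (S y) \<le> q * d x y" if "x \<in> Z" "y \<in> Z" for x y
  proof -
    let ?p = "\<lambda>e. ip x e - ip y e" and ?a = "\<lambda>e. A x e - A y e"
    have "(d (S x) (S y))\<^sup>2 = (\<Sum>e\<in>E. (?p e - \<rho> * ?a e)\<^sup>2)"
      using that by (simp add: d_def L2_set_def sum_nonneg ipS algebra_simps)
    also have "\<dots> = (\<Sum>e\<in>E. (?p e)\<^sup>2) - 2 * \<rho> * (\<Sum>e\<in>E. ?p e * ?a e) + \<rho>\<^sup>2 * (\<Sum>e\<in>E. (?a e)\<^sup>2)"
      by (simp add: sum_distrib_left sum_subtractf[symmetric] sum.distrib[symmetric]
          power2_eq_square algebra_simps)
    also have "\<dots> = (d x y)\<^sup>2 - 2 * \<rho> * (\<Sum>e\<in>E. ?p e * ?a e) + \<rho>\<^sup>2 * (\<Sum>e\<in>E. (?a e)\<^sup>2)"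
      by (simp add: d_def L2_set_def sum_nonneg)
    also have "\<dots> \<le> (d x y)\<^sup>2 - 2 * \<rho> * (\<gamma> * (d x y)\<^sup>2) + \<rho>\<^sup>2 * (M\<^sup>2 * (d x y)\<^sup>2)"
      using A_mono[OF that] A_lip[OF that] \<gamma> M
      by (intro add_mono diff_mono mult_left_mono) (auto simp: \<rho>_def)
    also have "\<dots> = (1 - \<gamma>\<^sup>2 / M\<^sup>2) * (d x y)\<^sup>2"
      using M(1) by (simp add: \<rho>_def field_simps power2_eq_square)
    also have "\<dots> = (q * d x y)\<^sup>2"
      by (simp add: power_mult_distrib q(2))
    finally show ?thesis
      by (rule power2_le_imp_le) (simp add: q(3))
  qed
  have "0 \<in> Z" using subspace_0[OF sub] .
  then have "Z \<noteq> {}" "S \<in> Z \<rightarrow> Z" using S by auto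
  then obtain x where x: "x \<in> Z" "S x = x"
    using Banach_fixedpoint_thm[OF \<open>mcomplete\<close> _ _ q(1) contr] by metis
  have Ae: "A x e = 0" if "e \<in> E" for e
    using ipS[OF x(1) that] x(2) \<gamma> M by (simp add: \<rho>_def)
  have A0: "A x v = 0" if "v \<in> Z" for v
  proof -
    have "A x v = A x (\<Sum>e\<in>E. ip v e *\<^sub>R e)" using basis[OF that] by simp
    also have "\<dots> = 0" using x by (simp add: A_sum Ae)
    finally show ?thesis .
  qed
  show ?thesis
  proof (rule ex1I)
    show "x \<in> Z \<and> (\<forall>v\<in>Z. A x v = 0)" using x A0 by blast
    fix y assume y: "y \<in> Z \<and> (\<forall>v\<in>Z. A y v = 0)"
    then have "ip (y - x) (y - x) \<le> 0"
      using mono[of y x] A0 x diffZ \<gamma> by (simp add: mult_le_0_iff)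
    then show "y = x"
      using ip_zero[of "y - x"] ip_nonneg[of "y - x"] diffZ x y by fastforce
  qed
qed

end

section \<open>Monotone problems for essentially bounded fields\<close>

text \<open>The bound is asked almost everywhere because gradients and strains of piecewise
  polynomials may take arbitrary values on the mesh edges.\<close>

definition ess_bounded :: "'a measure \<Rightarrow> ('a \<Rightarrow> 'b::euclidean_space) \<Rightarrow> bool" where
  "ess_bounded M f \<longleftrightarrow> f \<in> borel_measurable M \<and> (\<exists>B. AE x in M. norm (f x) \<le> B)"

lemma ess_boundedI: "f \<in> borel_measurable M \<Longrightarrow> (AE x in M. norm (f x) \<le> B) \<Longrightarrow> ess_bounded M f"
  unfolding ess_bounded_def by blast

lemma ess_boundedE:
  assumes "ess_bounded M f"
  obtains B where "f \<in> borel_measurable M" "B \<ge> 0" "AE x in M. norm (f x) \<le> B"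
proof -
  obtain B where B: "f \<in> borel_measurable M" "AE x in M. norm (f x) \<le> B"
    using assms unfolding ess_bounded_def by blast
  have "AE x in M. norm (f x) \<le> \<bar>B\<bar>" using B(2) by eventually_elim auto
  then show ?thesis using B that[of "\<bar>B\<bar>"] by simp
qed

lemma ess_bounded_measurable: "ess_bounded M f \<Longrightarrow> f \<in> borel_measurable M"
  by (simp add: ess_bounded_def)

lemma ess_bounded_const [intro]: "ess_bounded M (\<lambda>_. c)"
  by (rule ess_boundedI[where B = "norm c"]) auto

lemma ess_bounded_add [intro]:
  assumes "ess_bounded M f" "ess_bounded M g"
  shows "ess_bounded M (\<lambda>x. f x + g x)"
proof -
  obtain A B where "f \<in> borel_measurable M" "g \<in> borel_measurable M"
    and AB: "AE x in M. norm (f x) \<le> A" "AE x in M. norm (g x) \<le> B"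
    using assms unfolding ess_bounded_def by blast
  moreover from AB have "AE x in M. norm (f x + g x) \<le> A + B"
    by eventually_elim (meson norm_add_rule_thm)
  ultimately show ?thesis by (intro ess_boundedI) auto
qed

lemma ess_bounded_bilinear:
  assumes "bounded_bilinear h" "ess_bounded M f" "ess_bounded M g"
  shows "ess_bounded M (\<lambda>x. h (f x) (g x))"
proof -
  obtain A where A: "f \<in> borel_measurable M" "A \<ge> 0" "AE x in M. norm (f x) \<le> A"
    using assms(2) by (rule ess_boundedE)
  obtain B where B: "g \<in> borel_measurable M" "B \<ge> 0" "AE x in M. norm (g x) \<le> B"
    using assms(3) by (rule ess_boundedE)
  obtain C where C: "C \<ge> 0" "\<And>x y. norm (h x y) \<le> norm x * norm y * C"
    using bounded_bilinear.nonneg_bounded[OF assms(1)] by blast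
  show ?thesis
  proof (rule ess_boundedI)
    show "(\<lambda>x. h (f x) (g x)) \<in> borel_measurable M"
      by (rule borel_measurable_continuous_Pair[OF A(1) B(1)])
        (rule bounded_bilinear.continuous_on[OF assms(1)
            continuous_on_fst[OF continuous_on_id] continuous_on_snd[OF continuous_on_id]])
    show "AE x in M. norm (h (f x) (g x)) \<le> A * B * C"
      using A(3) B(3)
    proof eventually_elim
      case (elim x)
      have "norm (h (f x) (g x)) \<le> norm (f x) * norm (g x) * C" by (rule C(2))
      also have "\<dots> \<le> A * B * C"
        using elim A B C by (intro mult_right_mono mult_mono) auto
      finally show ?case .
    qed
  qed
qed

lemmas ess_bounded_inner [intro] = ess_bounded_bilinear[OF bounded_bilinear_inner]
lemmas ess_bounded_mult [intro] = ess_bounded_bilinear[OF bounded_bilinear_mult]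
lemmas ess_bounded_scaleR [intro] = ess_bounded_bilinear[OF bounded_bilinear_scaleR]

lemma ess_bounded_uminus [intro]: "ess_bounded M f \<Longrightarrow> ess_bounded M (\<lambda>x. - f x)"
  unfolding ess_bounded_def by auto

lemma ess_bounded_diff [intro]:
  "ess_bounded M f \<Longrightarrow> ess_bounded M g \<Longrightarrow> ess_bounded M (\<lambda>x. f x - g x)"
  using ess_bounded_add[OF _ ess_bounded_uminus, of M f g] by simp

lemma ess_bounded_Pair [intro]:
  assumes "ess_bounded M f" "ess_bounded M g"
  shows "ess_bounded M (\<lambda>x. (f x, g x))"
proof -
  obtain A where A: "f \<in> borel_measurable M" "A \<ge> 0" "AE x in M. norm (f x) \<le> A"
    using assms(1) by (rule ess_boundedE)
  obtain B where B: "g \<in> borel_measurable M" "B \<ge> 0" "AE x in M. norm (g x) \<le> B"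
    using assms(2) by (rule ess_boundedE)
  have "AE x in M. norm (f x, g x) \<le> A + B"
    using A(3) B(3)
  proof eventually_elim
    case (elim x)
    then show ?case using norm_Pair_le[of "f x" "g x"] by linarith
  qed
  then show ?thesis using A B by (intro ess_boundedI borel_measurable_Pair)
qed

lemma ess_bounded_integrable:
  fixes f :: "'a \<Rightarrow> real"
  assumes "finite_measure M" "ess_bounded M f"
  shows "integrable M f"
  using assms finite_measure.integrable_const_bound[OF assms(1)]
  unfolding ess_bounded_def by blast

text \<open>The hypotheses of the abstract theorem arise by integrating the pointwise ones, with
  \<open>ip z w\<close> the integral of \<open>D z \<bullet> D w\<close>; \<open>D_inj\<close> is
  its definiteness. \<open>S\<close> holds the values that the fields can take, and \<open>a\<close>
  is required to be monotone and Lipschitz there.\<close>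

theorem strongly_monotone_field_problem:
  fixes D :: "'z::real_vector \<Rightarrow> 'x \<Rightarrow> 'e::euclidean_space" and M :: "'x measure"
    and a :: "'x \<Rightarrow> 'e \<Rightarrow> 'e"
  assumes M: "finite_measure M"
    and Z: "subspace Z" "finite G" "Z \<subseteq> span G"
    and D_bdd: "\<And>z. z \<in> Z \<Longrightarrow> ess_bounded M (D z)"
    and D_add: "\<And>z w. \<lbrakk>z \<in> Z; w \<in> Z\<rbrakk> \<Longrightarrow> AE x in M. D (z + w) x = D z x + D w x"
    and D_scale: "\<And>z c. z \<in> Z \<Longrightarrow> AE x in M. D (c *\<^sub>R z) x = c *\<^sub>R D z x"
    and D_in: "\<And>z x. \<lbrakk>z \<in> Z; x \<in> space M\<rbrakk> \<Longrightarrow> D z x \<in> S"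
    and D_inj: "\<And>z. \<lbrakk>z \<in> Z; AE x in M. D z x = 0\<rbrakk> \<Longrightarrow> z = 0"
    and a_bdd: "\<And>z. z \<in> Z \<Longrightarrow> ess_bounded M (\<lambda>x. a x (D z x))"
    and \<gamma>: "\<gamma> > 0"
    and a_mono: "\<And>x X Y. \<lbrakk>x \<in> space M; X \<in> S; Y \<in> S\<rbrakk> \<Longrightarrow>
      \<gamma> * (norm (X - Y))\<^sup>2 \<le> (a x X - a x Y) \<bullet> (X - Y)"
    and a_lip: "\<And>x X Y. \<lbrakk>x \<in> space M; X \<in> S; Y \<in> S\<rbrakk> \<Longrightarrow>
      norm (a x X - a x Y) \<le> L * norm (X - Y)"
    and l_add: "\<And>z w. \<lbrakk>z \<in> Z; w \<in> Z\<rbrakk> \<Longrightarrow> l (z + w) = l z + l w"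
    and l_scale: "\<And>z c. z \<in> Z \<Longrightarrow> l (c *\<^sub>R z) = c * l z"
  shows "\<exists>!z. z \<in> Z \<and> (\<forall>w\<in>Z. (\<integral>x. a x (D z x) \<bullet> D w x \<partial>M) = l w)"
proof -
  define ip where "ip z w = (\<integral>x. D z x \<bullet> D w x \<partial>M)" for z w
  define A where "A z w = (\<integral>x. a x (D z x) \<bullet> D w x \<partial>M) - l w" for z w
  have int: "integrable M (\<lambda>x. f x \<bullet> g x)"
    if "ess_bounded M f" "ess_bounded M g" for f g :: "'x \<Rightarrow> 'e"
    using that by (intro ess_bounded_integrable[OF M]) auto
  have D_meas: "D z \<in> borel_measurable M" if "z \<in> Z" for z
    using ess_bounded_measurable[OF D_bdd[OF that]] .
  have pair_add: "(\<integral>x. f x \<bullet> D (v + w) x \<partial>M) = (\<integral>x. f x \<bullet> D v x \<partial>M) + (\<integral>x. f x \<bullet> D w x \<partial>M)"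
    if "ess_bounded M f" "v \<in> Z" "w \<in> Z" for f v w
  proof -
    have "(\<integral>x. f x \<bullet> D (v + w) x \<partial>M) = (\<integral>x. f x \<bullet> D v x + f x \<bullet> D w x \<partial>M)"
    proof (rule integral_cong_AE)
      show "AE x in M. f x \<bullet> D (v + w) x = f x \<bullet> D v x + f x \<bullet> D w x"
        using D_add[OF that(2,3)] by eventually_elim (simp add: inner_add_right)
    qed (use that D_meas subspace_add[OF Z(1)] ess_bounded_measurable in
        \<open>auto intro!: borel_measurable_inner borel_measurable_add\<close>)
    also have "\<dots> = (\<integral>x. f x \<bullet> D v x \<partial>M) + (\<integral>x. f x \<bullet> D w x \<partial>M)"
      by (intro Bochner_Integration.integral_add int that D_bdd)
    finally show ?thesis .
  qed
  have pair_scale: "(\<integral>x. f x \<bullet> D (c *\<^sub>R v) x \<partial>M) = c * (\<integral>x. f x \<bullet> D v x \<partial>M)"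
    if "ess_bounded M f" "v \<in> Z" for f v c
  proof -
    have "(\<integral>x. f x \<bullet> D (c *\<^sub>R v) x \<partial>M) = (\<integral>x. c * (f x \<bullet> D v x) \<partial>M)"
    proof (rule integral_cong_AE)
      show "AE x in M. f x \<bullet> D (c *\<^sub>R v) x = c * (f x \<bullet> D v x)"
        using D_scale[OF that(2), of c] by eventually_elim simp
    qed (use that D_meas subspace_scale[OF Z(1)] ess_bounded_measurable in
        \<open>auto intro!: borel_measurable_inner borel_measurable_times\<close>)
    then show ?thesis by simp
  qed
  have D_diff: "AE x in M. D (z - w) x = D z x - D w x" if "z \<in> Z" "w \<in> Z" for z w
  proof -
    have "AE x in M. D (z - w + w) x = D (z - w) x + D w x"
      using that by (intro D_add subspace_diff[OF Z(1)])
    then show ?thesis by eventually_elim (simp add: algebra_simps)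
  qed
  interpret finite_dim_inner Z ip G
  proof
    show "subspace Z" "finite G" "Z \<subseteq> span G" by fact+
    show comm: "ip x y = ip y x" for x y by (simp add: ip_def inner_commute)
    show "ip (x + y) w = ip x w + ip y w" if "x \<in> Z" "y \<in> Z" "w \<in> Z" for x y w
      unfolding comm[of _ w] using pair_add[OF D_bdd[OF that(3)] that(1,2)] by (simp add: ip_def)
    show "ip (c *\<^sub>R x) w = c * ip x w" if "x \<in> Z" "w \<in> Z" for x w c
      unfolding comm[of _ w] using pair_scale[OF D_bdd[OF that(2)] that(1)] by (simp add: ip_def)
    show "0 \<le> ip x x" for x by (simp add: ip_def)
    show "x = 0" if "x \<in> Z" "ip x x = 0" for x
    proof (rule D_inj[OF that(1)])
      have "AE t in M. D x t \<bullet> D x t = 0"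
        using that int[OF D_bdd D_bdd] integral_nonneg_eq_0_iff_AE[of M "\<lambda>t. D x t \<bullet> D x t"]
        by (simp add: ip_def)
      then show "AE t in M. D x t = 0" by eventually_elim simp
    qed
  qed
  have "\<exists>!z. z \<in> Z \<and> (\<forall>w\<in>Z. A z w = 0)"
  proof (rule strongly_monotone_unique_zero)
    show "A x (v + w) = A x v + A x w" if "x \<in> Z" "v \<in> Z" "w \<in> Z" for x v w
      using that by (simp add: A_def pair_add a_bdd l_add)
    show "A x (c *\<^sub>R v) = c * A x v" if "x \<in> Z" "v \<in> Z" for x v c
      using that by (simp add: A_def pair_scale a_bdd l_scale algebra_simps)
    have A_diff: "A x v - A y v = (\<integral>t. (a t (D x t) - a t (D y t)) \<bullet> D v t \<partial>M)"
      and A_int: "integrable M (\<lambda>t. (a t (D x t) - a t (D y t)) \<bullet> D v t)"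
      if "x \<in> Z" "y \<in> Z" "v \<in> Z" for x y v
      using that by (auto simp: A_def inner_diff_left int a_bdd D_bdd)
    show "\<gamma> > 0" by fact
    show "A x (x - y) - A y (x - y) \<ge> \<gamma> * ip (x - y) (x - y)" if "x \<in> Z" "y \<in> Z" for x y
    proof -
      have xy: "x - y \<in> Z" using subspace_diff[OF Z(1) that] .
      have "(\<integral>t. \<gamma> * (D (x - y) t \<bullet> D (x - y) t) \<partial>M)
          \<le> (\<integral>t. (a t (D x t) - a t (D y t)) \<bullet> D (x - y) t \<partial>M)"
      proof (rule integral_mono_AE)
        show "AE t in M. \<gamma> * (D (x - y) t \<bullet> D (x - y) t)
            \<le> (a t (D x t) - a t (D y t)) \<bullet> D (x - y) t"
          using D_diff[OF that] AE_space
          by eventually_elim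
            (use a_mono D_in that in \<open>auto simp: power2_norm_eq_inner[symmetric]\<close>)
      qed (use xy that in \<open>auto intro!: A_int int D_bdd a_bdd ess_bounded_diff\<close>)
      then show ?thesis using A_diff[OF that xy] by (simp add: ip_def)
    qed
    show "2 * (A x v - A y v) \<le> L\<^sup>2 * ip (x - y) (x - y) + ip v v"
      if "x \<in> Z" "y \<in> Z" "v \<in> Z" for x y v
    proof -
      have xy: "x - y \<in> Z" using subspace_diff[OF Z(1)] that by blast
      have "(\<integral>t. 2 * ((a t (D x t) - a t (D y t)) \<bullet> D v t) \<partial>M)
          \<le> (\<integral>t. L\<^sup>2 * (D (x - y) t \<bullet> D (x - y) t) + D v t \<bullet> D v t \<partial>M)"
      proof (rule integral_mono_AE)
        show "AE t in M. 2 * ((a t (D x t) - a t (D y t)) \<bullet> D v t)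
            \<le> L\<^sup>2 * (D (x - y) t \<bullet> D (x - y) t) + D v t \<bullet> D v t"
          using D_diff[OF that(1,2)] AE_space
        proof eventually_elim
          case (elim t)
          let ?d = "D x t - D y t"
          have "(a t (D x t) - a t (D y t)) \<bullet> D v t
              \<le> norm (a t (D x t) - a t (D y t)) * norm (D v t)" by (rule norm_cauchy_schwarz)
          also have "\<dots> \<le> (L * norm ?d) * norm (D v t)"
            using a_lip D_in that elim by (intro mult_right_mono) auto
          \<comment> \<open>Young's inequality \<open>2 * a * b \<le> a^2 + b^2\<close> gives the
            form of Lipschitz bound that the abstract theorem takes.\<close>
          also have "2 * \<dots> \<le> (L * norm ?d)\<^sup>2 + (norm (D v t))\<^sup>2"
            using sum_squares_bound[of "L * norm ?d" "norm (D v t)"] by simp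
          finally show ?case
            using elim by (simp add: power_mult_distrib power2_norm_eq_inner)
        qed
      qed (use xy that in \<open>auto intro!: A_int int D_bdd a_bdd ess_bounded_diff\<close>)
      also have "\<dots> = L\<^sup>2 * ip (x - y) (x - y) + ip v v"
        using xy that by (simp add: ip_def int D_bdd)
      finally show ?thesis using A_diff[OF that] by simp
    qed
  qed
  then show ?thesis by (simp add: A_def)
qed

section \<open>Piecewise polynomials\<close>

text \<open>The gradient is continuous on the whole space, not only on a cell: on a compact cell it
  is then bounded up to the edges.\<close>

definition C1_fun :: "('a::real_inner \<Rightarrow> real) \<Rightarrow> bool" where
  "C1_fun q \<longleftrightarrow> (\<exists>Dq. continuous_on UNIV Dq \<and> (\<forall>x. (q has_derivative (\<lambda>h. Dq x \<bullet> h)) (at x)))"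

lemma C1_fun_continuous: "C1_fun q \<Longrightarrow> continuous_on S q"
  unfolding C1_fun_def
  by (intro continuous_at_imp_continuous_on ballI) (elim exE conjE allE, rule has_derivative_continuous)

lemma C1_fun_const: "C1_fun (\<lambda>_. c)"
proof -
  have "(\<bullet>) (0::'a) = (\<lambda>_. 0)" by auto
  then show ?thesis
    unfolding C1_fun_def by (intro exI[of _ "\<lambda>_. 0"]) simp
qed

lemma C1_fun_nth: "C1_fun (\<lambda>x::real^'n. x $ i)"
  unfolding C1_fun_def
proof (intro exI[of _ "\<lambda>_. axis i 1"] conjI allI)
  show "((\<lambda>x. x $ i) has_derivative (\<lambda>h. axis i 1 \<bullet> h)) (at x)" for x :: "real^'n"
    using bounded_linear_imp_has_derivative[OF bounded_linear_vec_nth]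
    by (simp add: inner_axis')
qed simp

lemma C1_fun_add:
  assumes "C1_fun p" "C1_fun q"
  shows "C1_fun (\<lambda>x. p x + q x)"
proof -
  obtain Dp Dq where "continuous_on UNIV Dp" "\<And>x. (p has_derivative (\<lambda>h. Dp x \<bullet> h)) (at x)"
      "continuous_on UNIV Dq" "\<And>x. (q has_derivative (\<lambda>h. Dq x \<bullet> h)) (at x)"
    using assms unfolding C1_fun_def by blast
  then have "continuous_on UNIV (\<lambda>x. Dp x + Dq x)"
      "\<And>x. ((\<lambda>x. p x + q x) has_derivative (\<lambda>h. (Dp x + Dq x) \<bullet> h)) (at x)"
    unfolding inner_add_left by (auto intro: continuous_on_add has_derivative_add)
  then show ?thesis unfolding C1_fun_def by blast
qed

lemma C1_fun_mult:
  assumes "C1_fun p" "C1_fun q"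
  shows "C1_fun (\<lambda>x. p x * q x)"
proof -
  obtain Dp Dq where D: "continuous_on UNIV Dp" "\<And>x. (p has_derivative (\<lambda>h. Dp x \<bullet> h)) (at x)"
      "continuous_on UNIV Dq" "\<And>x. (q has_derivative (\<lambda>h. Dq x \<bullet> h)) (at x)"
    using assms unfolding C1_fun_def by blast
  have "continuous_on UNIV (\<lambda>x. p x *\<^sub>R Dq x + q x *\<^sub>R Dp x)"
    by (intro continuous_on_add continuous_on_scaleR D C1_fun_continuous assms)
  moreover have "((\<lambda>x. p x * q x) has_derivative (\<lambda>h. (p x *\<^sub>R Dq x + q x *\<^sub>R Dp x) \<bullet> h)) (at x)" for x
    using has_derivative_mult[OF D(2)[of x] D(4)[of x]]
    by (simp add: inner_add_left algebra_simps)
  ultimately show ?thesis unfolding C1_fun_def by blast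
qed

lemma C1_fun_power: "C1_fun p \<Longrightarrow> C1_fun (\<lambda>x. p x ^ n)"
  by (induction n) (auto intro: C1_fun_const C1_fun_mult)

lemma C1_fun_sum: "(\<And>i. i \<in> I \<Longrightarrow> C1_fun (p i)) \<Longrightarrow> C1_fun (\<lambda>x. \<Sum>i\<in>I. p i x)"
  by (induction I rule: infinite_finite_induct) (auto intro: C1_fun_const C1_fun_add)

lemma poly_deg_le_on_C1:
  assumes "poly_deg_le_on k S p"
  obtains q where "C1_fun q" "\<And>x. x \<in> S \<Longrightarrow> p x = q x"
proof -
  obtain c where c: "\<And>x. x \<in> S \<Longrightarrow> p x = (\<Sum>i\<le>k. \<Sum>j\<le>k - i. c i j * (x$1)^i * (x$2)^j)"
    using assms unfolding poly_deg_le_on_def by blast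
  have "C1_fun (\<lambda>x::real^2. \<Sum>i\<le>k. \<Sum>j\<le>k - i. c i j * (x$1)^i * (x$2)^j)"
    by (intro C1_fun_sum C1_fun_mult C1_fun_power C1_fun_nth C1_fun_const)
  then show ?thesis using c that by blast
qed

lemma poly_deg_le_on_add:
  assumes "poly_deg_le_on k S p" "poly_deg_le_on k S q"
  shows "poly_deg_le_on k S (\<lambda>x. p x + q x)"
proof -
  obtain c where "\<forall>x\<in>S. p x = (\<Sum>i\<le>k. \<Sum>j\<le>k - i. c i j * (x$1)^i * (x$2)^j)"
    using assms(1) unfolding poly_deg_le_on_def by blast
  moreover obtain d where "\<forall>x\<in>S. q x = (\<Sum>i\<le>k. \<Sum>j\<le>k - i. d i j * (x$1)^i * (x$2)^j)"
    using assms(2) unfolding poly_deg_le_on_def by blast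
  ultimately show ?thesis
    unfolding poly_deg_le_on_def
    by (intro exI[of _ "\<lambda>i j. c i j + d i j"]) (simp add: sum.distrib distrib_right)
qed

lemma poly_deg_le_on_scale:
  assumes "poly_deg_le_on k S p"
  shows "poly_deg_le_on k S (\<lambda>x. r * p x)"
proof -
  obtain c where "\<forall>x\<in>S. p x = (\<Sum>i\<le>k. \<Sum>j\<le>k - i. c i j * (x$1)^i * (x$2)^j)"
    using assms unfolding poly_deg_le_on_def by blast
  then show ?thesis
    unfolding poly_deg_le_on_def
    by (intro exI[of _ "\<lambda>i j. r * c i j"]) (simp add: sum_distrib_left mult.assoc)
qed

lemma subspace_Lagrange_space: "subspace (Lagrange_space k Tr D)"
proof (rule subspaceI)
  show "0 \<in> Lagrange_space k Tr D"
    unfolding Lagrange_space_def poly_deg_le_on_def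
    by (auto simp: zero_fun_def intro: exI[of _ "\<lambda>_ _. 0"])
  show "p + q \<in> Lagrange_space k Tr D"
    if "p \<in> Lagrange_space k Tr D" "q \<in> Lagrange_space k Tr D" for p q
    using that unfolding Lagrange_space_def plus_fun_def
    by (auto intro: continuous_on_add poly_deg_le_on_add)
  show "c *\<^sub>R p \<in> Lagrange_space k Tr D" if "p \<in> Lagrange_space k Tr D" for c p
    using that unfolding Lagrange_space_def scaleR_fun_def
    by (auto intro: continuous_on_mult_left poly_deg_le_on_scale)
qed

text \<open>The points of \<open>D\<close> lying on several cells are assigned to one of them, \<open>T x\<close>, so that the
  monomials cut off to the fibres of \<open>T\<close> span.\<close>

lemma Lagrange_space_finite_dim:
  assumes "finite Tr" "D \<subseteq> (\<Union>V\<in>Tr. convex hull V)"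
  shows "\<exists>G. finite G \<and> Lagrange_space k Tr D \<subseteq> span G"
proof -
  define T where "T x = (SOME V. V \<in> Tr \<and> x \<in> convex hull V)" for x
  have T: "T x \<in> Tr" "x \<in> convex hull (T x)" if "x \<in> D" for x
  proof -
    have "\<exists>V. V \<in> Tr \<and> x \<in> convex hull V" using that assms(2) by blast
    then have "T x \<in> Tr \<and> x \<in> convex hull (T x)" unfolding T_def by (rule someI_ex)
    then show "T x \<in> Tr" "x \<in> convex hull (T x)" by auto
  qed
  define m where "m V i j x = (if x \<in> D \<and> T x = V then (x$1)^i * (x$2)^j else 0)"
    for V i j and x :: "real^2"
  define G where "G = (\<lambda>(V, i, j). m V i j) ` (Tr \<times> {..k} \<times> {..k})"
  have "p \<in> span G" if p: "p \<in> Lagrange_space k Tr D" for p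
  proof -
    have "\<forall>V\<in>Tr. \<exists>c. \<forall>x\<in>convex hull V. p x = (\<Sum>i\<le>k. \<Sum>j\<le>k - i. c i j * (x$1)^i * (x$2)^j)"
      using p unfolding Lagrange_space_def poly_deg_le_on_def by blast
    from bchoice[OF this] obtain c where
      c: "\<And>V x. V \<in> Tr \<Longrightarrow> x \<in> convex hull V \<Longrightarrow>
            p x = (\<Sum>i\<le>k. \<Sum>j\<le>k - i. c V i j * (x$1)^i * (x$2)^j)"
      by blast
    have "p x = (\<Sum>V\<in>Tr. \<Sum>i\<le>k. \<Sum>j\<le>k - i. c V i j *\<^sub>R m V i j) x" for x
    proof (cases "x \<in> D")
      case True
      have "(\<Sum>V\<in>Tr. \<Sum>i\<le>k. \<Sum>j\<le>k - i. c V i j *\<^sub>R m V i j) x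
          = (\<Sum>V\<in>Tr. if T x = V then \<Sum>i\<le>k. \<Sum>j\<le>k - i. c V i j * ((x$1)^i * (x$2)^j) else 0)"
        unfolding sum_fun_apply by (intro sum.cong refl) (auto simp: m_def True)
      also have "\<dots> = p x"
        using c[OF T[OF True]] T[OF True] assms(1) by (simp add: mult.assoc)
      finally show ?thesis by simp
    next
      case False
      then show ?thesis
        using p by (simp add: Lagrange_space_def sum_fun_apply m_def)
    qed
    then have "p = (\<Sum>V\<in>Tr. \<Sum>i\<le>k. \<Sum>j\<le>k - i. c V i j *\<^sub>R m V i j)" by blast
    also have "\<dots> \<in> span G"
      by (intro span_sum span_scale span_base) (force simp: G_def)
    finally show ?thesis .
  qed
  moreover have "finite G" using assms(1) by (simp add: G_def)
  ultimately show ?thesis by blast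
qed

section \<open>Pointwise derivatives and almost everywhere identities\<close>

lemma jac_eq: "(v has_derivative (\<lambda>h. J *v h)) (at x) \<Longrightarrow> jac v x = J"
  by (simp add: jac_def frechet_derivative_at[symmetric] vec_eq_iff matrix_vector_mul_component
      inner_axis)

lemma grad_eq: "(p has_derivative (\<lambda>h. d \<bullet> h)) (at x) \<Longrightarrow> grad p x = d"
  by (simp add: grad_def frechet_derivative_at[symmetric] vec_eq_iff inner_axis)

lemma AE_lebesgue_on_negligible:
  assumes "negligible (\<Omega> - S)" "\<Omega> \<in> sets lebesgue"
  shows "AE x in lebesgue_on \<Omega>. x \<in> S"
proof -
  have "\<Omega> - S \<in> null_sets lebesgue" using assms(1) by (simp add: negligible_iff_null_sets)
  then have "AE x in lebesgue. x \<in> \<Omega> \<longrightarrow> x \<in> S"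
    by (rule AE_I') auto
  then show ?thesis using assms(2) by (subst AE_restrict_space_iff) auto
qed

text \<open>The points of \<open>U\<close> where \<open>h\<close> is nonzero form an open null set,
  and a nonempty open set is never null.\<close>

lemma AE_continuous_zero:
  fixes h :: "'a::euclidean_space \<Rightarrow> 'b::real_normed_vector"
  assumes "open U" "U \<subseteq> \<Omega>" "\<Omega> \<in> sets lebesgue" "continuous_on U h"
    and "AE x in lebesgue_on \<Omega>. h x = 0" "x \<in> U"
  shows "h x = 0"
proof (rule ccontr)
  assume "h x \<noteq> 0"
  let ?W = "{y\<in>U. h y \<noteq> 0}"
  have "open (U \<inter> h -` (- {0}))"
    by (rule continuous_open_preimage[OF assms(4,1)]) auto
  moreover have "U \<inter> h -` (- {0}) = ?W" by auto
  ultimately have "open ?W" by simp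
  have "AE x in lebesgue. x \<in> \<Omega> \<longrightarrow> h x = 0"
    using assms(3,5) by (subst (asm) AE_restrict_space_iff) auto
  then have "AE x in lebesgue. x \<notin> ?W"
    by (rule eventually_mono) (use assms(2) in auto)
  then have "?W \<in> null_sets lebesgue"
    unfolding completion.AE_iff_null_sets by simp
  then have "negligible ?W" by (simp add: negligible_iff_null_sets)
  then show False
    using open_not_negligible[OF \<open>open ?W\<close>] \<open>h x \<noteq> 0\<close> assms(6) by blast
qed

section \<open>Discrete spaces on a triangulated domain\<close>

definition finite_dim :: "'a::real_vector set \<Rightarrow> bool" where
  "finite_dim S \<longleftrightarrow> (\<exists>G. finite G \<and> S \<subseteq> span G)"

lemma finite_dim_subset: "finite_dim T \<Longrightarrow> S \<subseteq> T \<Longrightarrow> finite_dim S"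
  unfolding finite_dim_def by blast

lemma finite_dim_linear_image:
  assumes "linear f" "finite_dim S"
  shows "finite_dim (f ` S)"
proof -
  obtain G where "finite G" "S \<subseteq> span G" using assms(2) unfolding finite_dim_def by blast
  then have "finite (f ` G)" "f ` S \<subseteq> span (f ` G)"
    using linear_span_image[OF assms(1)] by auto
  then show ?thesis unfolding finite_dim_def by blast
qed

lemma finite_dim_sums:
  assumes "finite_dim S" "finite_dim T"
  shows "finite_dim {s + t | s t. s \<in> S \<and> t \<in> T}"
proof -
  obtain G H where GH: "finite G" "S \<subseteq> span G" "finite H" "T \<subseteq> span H"
    using assms unfolding finite_dim_def by blast
  have "span G \<subseteq> span (G \<union> H)" "span H \<subseteq> span (G \<union> H)" by (simp_all add: span_mono)
  then have "{s + t | s t. s \<in> S \<and> t \<in> T} \<subseteq> span (G \<union> H)"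
    using GH by (auto intro!: span_add)
  then show ?thesis using GH unfolding finite_dim_def by blast
qed

lemma finite_dim_Times:
  assumes "finite_dim S" "finite_dim T"
  shows "finite_dim (S \<times> T)"
proof (rule finite_dim_subset[OF finite_dim_sums])
  show "finite_dim ((\<lambda>x. (x, 0)) ` S)" "finite_dim ((\<lambda>x. (0, x)) ` T)"
    by (intro finite_dim_linear_image assms linearI; simp)+
  show "S \<times> T \<subseteq> {s + t | s t. s \<in> (\<lambda>x. (x, 0)) ` S \<and> t \<in> (\<lambda>x. (0, x)) ` T}"
    by force
qed

locale triangulated_domain =
  fixes \<Omega> :: "(real^2) set" and Tr :: "(real^2) set set"
  assumes dom: "convex_polygonal_domain \<Omega>"
    and mesh: "conforming_triangulation Tr (closure \<Omega>)"
begin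

lemma open_domain: "open \<Omega>" and convex_domain: "convex \<Omega>" and bounded_domain: "bounded \<Omega>"
    and nonempty_domain: "\<Omega> \<noteq> {}"
proof -
  obtain P where P: "finite P" "\<Omega> = interior (convex hull P)" "\<Omega> \<noteq> {}"
    using dom unfolding convex_polygonal_domain_def by blast
  then show "open \<Omega>" "convex \<Omega>" "\<Omega> \<noteq> {}" by (simp_all add: convex_interior)
  show "bounded \<Omega>"
    using P by (meson bounded_convex_hull bounded_subset finite_imp_bounded interior_subset)
qed

lemma compact_closure_domain: "compact (closure \<Omega>)"
  using bounded_domain by simp

lemma interior_closure_domain: "interior (closure \<Omega>) = \<Omega>"
  using convex_interior_closure[OF convex_domain] interior_open[OF open_domain] by simp

lemma lmeasurable_domain: "\<Omega> \<in> lmeasurable"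
  using bounded_domain open_domain by (rule lmeasurable_open)

lemma sets_domain: "\<Omega> \<in> sets lebesgue"
  using lmeasurable_domain by auto

lemma finite_measure_domain: "finite_measure (lebesgue_on \<Omega>)"
  by (rule finite_measure_lebesgue_on[OF lmeasurable_domain])

lemma finite_Tr: "finite Tr"
  and cells_cover: "(\<Union>V\<in>Tr. convex hull V) = closure \<Omega>"
  using mesh by (auto simp: conforming_triangulation_def)

text \<open>Three affinely independent points of the plane span a triangle with nonempty interior,
  and a convex set with interior lies in the closure of it. Cell interiors fall into \<Omega>
  because an open convex set is the interior of its closure.\<close>

lemma
  assumes "V \<in> Tr"
  shows compact_cell: "compact (convex hull V)"
    and closure_interior_cell: "closure (interior (convex hull V)) = convex hull V"
    and interior_cell_subset: "interior (convex hull V) \<subseteq> \<Omega>"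
proof -
  have V: "card V = 3" "\<not> affine_dependent V"
    using mesh assms by (auto simp: conforming_triangulation_def triangle_verts_def)
  then have "finite V" using card.infinite by fastforce
  then show c: "compact (convex hull V)" by (rule finite_imp_compact_convex_hull)
  have "interior (convex hull V) \<noteq> {}"
    using V interior_convex_hull_eq_empty[of V] by simp
  then show "closure (interior (convex hull V)) = convex hull V"
    using convex_closure_interior[of "convex hull V"] compact_imp_closed[OF c] by simp
  have "convex hull V \<subseteq> closure \<Omega>" using assms cells_cover by blast
  then show "interior (convex hull V) \<subseteq> \<Omega>"
    using interior_mono interior_closure_domain by blast
qed

definition "cell_interiors = (\<Union>V\<in>Tr. interior (convex hull V))"

lemma open_cell_interiors: "open cell_interiors"
  and cell_interiors_subset: "cell_interiors \<subseteq> \<Omega>"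
  using interior_cell_subset by (auto simp: cell_interiors_def)

text \<open>The exceptional points lie on finitely many frontiers of convex sets, which are
  negligible.\<close>

lemma AE_cell_interiors: "AE x in lebesgue_on \<Omega>. x \<in> cell_interiors"
proof (rule AE_lebesgue_on_negligible[OF _ sets_domain])
  have "negligible (\<Union>V\<in>Tr. frontier (convex hull V))"
    using finite_Tr by (intro negligible_Union) (auto intro: negligible_convex_frontier)
  moreover have "\<Omega> - cell_interiors \<subseteq> (\<Union>V\<in>Tr. frontier (convex hull V))"
  proof
    fix x assume x: "x \<in> \<Omega> - cell_interiors"
    then obtain V where V: "V \<in> Tr" "x \<in> convex hull V"
      using cells_cover closure_subset by blast
    then have "x \<in> frontier (convex hull V)"
      using x closure_subset by (auto simp: frontier_def cell_interiors_def)
    then show "x \<in> (\<Union>V\<in>Tr. frontier (convex hull V))" using V by blast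
  qed
  ultimately show "negligible (\<Omega> - cell_interiors)" by (rule negligible_subset)
qed

text \<open>Nothing is known about \<open>h\<close> on the edges. Measurability is obtained on the
  open union of cell interiors and extended over the remaining null set by completeness of Lebesgue
  measure; compactness of the finitely many cells gives the bound.\<close>

lemma ess_bounded_piecewise:
  fixes h :: "real^2 \<Rightarrow> 'b::euclidean_space"
  assumes "\<And>V. V \<in> Tr \<Longrightarrow> \<exists>q. continuous_on UNIV q \<and> (\<forall>x\<in>interior (convex hull V). h x = q x)"
  shows "ess_bounded (lebesgue_on \<Omega>) h"
proof -
  have cont: "continuous_on (interior (convex hull V)) h"
    and bdd: "bounded (h ` interior (convex hull V))" if "V \<in> Tr" for V
  proof -
    obtain q where q: "continuous_on UNIV q" "\<And>x. x \<in> interior (convex hull V) \<Longrightarrow> h x = q x"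
      using assms[OF \<open>V \<in> Tr\<close>] by blast
    show "continuous_on (interior (convex hull V)) h"
      using continuous_on_subset[OF q(1)] q(2) by (simp cong: continuous_on_cong)
    have "compact (q ` (convex hull V))"
      using compact_cell[OF that] continuous_on_subset[OF q(1)] by (intro compact_continuous_image) auto
    moreover have "h ` interior (convex hull V) \<subseteq> q ` (convex hull V)"
      using q(2) interior_subset by force
    ultimately show "bounded (h ` interior (convex hull V))"
      using compact_imp_bounded bounded_subset by blast
  qed
  have "continuous_on cell_interiors h"
    unfolding cell_interiors_def by (intro continuous_on_open_UN cont) auto
  then have "h \<in> borel_measurable (lebesgue_on cell_interiors)"
    by (rule continuous_imp_measurable_on_sets_lebesgue) (simp add: open_cell_interiors)
  then have "(\<lambda>x. indicator cell_interiors x *\<^sub>R h x) \<in> borel_measurable lebesgue"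
    by (subst (asm) borel_measurable_restrict_space_iff) (simp_all add: open_cell_interiors)
  moreover have "AE x in lebesgue. indicator cell_interiors x *\<^sub>R h x = indicator \<Omega> x *\<^sub>R h x"
  proof -
    have "AE x in lebesgue. x \<in> \<Omega> \<longrightarrow> x \<in> cell_interiors"
      using AE_cell_interiors sets_domain by (subst (asm) AE_restrict_space_iff) auto
    then show ?thesis
      by (rule eventually_mono) (use cell_interiors_subset in \<open>auto split: split_indicator\<close>)
  qed
  ultimately have "(\<lambda>x. indicator \<Omega> x *\<^sub>R h x) \<in> borel_measurable lebesgue"
    by (rule borel_measurable_AE)
  then have meas: "h \<in> borel_measurable (lebesgue_on \<Omega>)"
    by (subst borel_measurable_restrict_space_iff) (simp_all add: sets_domain)
  have "bounded (h ` cell_interiors)"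
    unfolding cell_interiors_def image_UN using finite_Tr bdd by (intro bounded_UN) auto
  then obtain B where "\<And>x. x \<in> cell_interiors \<Longrightarrow> norm (h x) \<le> B"
    unfolding bounded_iff by blast
  then have "AE x in lebesgue_on \<Omega>. norm (h x) \<le> B"
    using AE_cell_interiors by (auto elim: eventually_mono)
  with meas show ?thesis by (rule ess_boundedI)
qed

lemma ess_bounded_continuous:
  fixes h :: "real^2 \<Rightarrow> 'b::euclidean_space"
  assumes "continuous_on (closure \<Omega>) h"
  shows "ess_bounded (lebesgue_on \<Omega>) h"
proof -
  have "continuous_on \<Omega> h" using assms closure_subset by (rule continuous_on_subset)
  then have "h \<in> borel_measurable (lebesgue_on \<Omega>)"
    using sets_domain by (rule continuous_imp_measurable_on_sets_lebesgue)
  moreover obtain B where "\<And>x. x \<in> closure \<Omega> \<Longrightarrow> norm (h x) \<le> B"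
    using compact_imp_bounded[OF compact_continuous_image[OF assms compact_closure_domain]]
    unfolding bounded_iff by blast
  then have "AE x in lebesgue_on \<Omega>. norm (h x) \<le> B"
    using closure_subset by (intro AE_I2) auto
  ultimately show ?thesis by (rule ess_boundedI)
qed

text \<open>The polynomial of a cell is differentiable on the whole plane and agrees with
  \<open>p\<close> on the open interior, so it passes on its derivative there. On an edge
  \<open>p\<close> may have a kink.\<close>

lemma Lagrange_space_on_cell:
  assumes "p \<in> Lagrange_space k Tr (closure \<Omega>)" "V \<in> Tr"
  obtains Dq where "continuous_on UNIV Dq"
    "\<And>x. x \<in> interior (convex hull V) \<Longrightarrow> (p has_derivative (\<lambda>h. Dq x \<bullet> h)) (at x)"
proof -
  have "poly_deg_le_on k (convex hull V) p" using assms by (simp add: Lagrange_space_def)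
  then obtain q where "C1_fun q" and q: "\<And>x. x \<in> convex hull V \<Longrightarrow> p x = q x"
    using poly_deg_le_on_C1 by blast
  then obtain Dq where Dq: "continuous_on UNIV Dq" "\<And>x. (q has_derivative (\<lambda>h. Dq x \<bullet> h)) (at x)"
    unfolding C1_fun_def by blast
  have "(p has_derivative (\<lambda>h. Dq x \<bullet> h)) (at x)" if "x \<in> interior (convex hull V)" for x
    using Dq(2) open_interior that
    by (rule has_derivative_transform_within_open) (use q interior_subset in force)
  then show ?thesis using Dq(1) that by blast
qed

lemma X_h_on_cell:
  assumes "v \<in> X_h Tr \<Omega>" "V \<in> Tr"
  obtains J where "continuous_on UNIV J"
    "\<And>x. x \<in> interior (convex hull V) \<Longrightarrow> (v has_derivative (\<lambda>h. J x *v h)) (at x)"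
proof -
  have "\<forall>i. \<exists>Dq. continuous_on UNIV Dq \<and>
      (\<forall>x\<in>interior (convex hull V). ((\<lambda>x. v x $ i) has_derivative (\<lambda>h. Dq x \<bullet> h)) (at x))"
  proof
    fix i
    have "(\<lambda>x. v x $ i) \<in> Lagrange_space 2 Tr (closure \<Omega>)"
      using assms(1) by (simp add: X_h_def)
    then obtain Dq where "continuous_on UNIV Dq" "\<And>x. x \<in> interior (convex hull V) \<Longrightarrow>
        ((\<lambda>x. v x $ i) has_derivative (\<lambda>h. Dq x \<bullet> h)) (at x)"
      using Lagrange_space_on_cell[OF _ assms(2)] by blast
    then show "\<exists>Dq. continuous_on UNIV Dq \<and>
      (\<forall>x\<in>interior (convex hull V). ((\<lambda>x. v x $ i) has_derivative (\<lambda>h. Dq x \<bullet> h)) (at x))"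
      by blast
  qed
  from choice[OF this] obtain Dq where Dq: "\<And>i. continuous_on UNIV (Dq i)"
      "\<And>i x. x \<in> interior (convex hull V) \<Longrightarrow>
        ((\<lambda>x. v x $ i) has_derivative (\<lambda>h. Dq i x \<bullet> h)) (at x)"
    by blast
  have "continuous_on UNIV (\<lambda>x. \<chi> i. Dq i x)"
    using Dq(1) by (intro continuous_on_vec_lambda)
  moreover have "(v has_derivative (\<lambda>h. (\<chi> i. Dq i x) *v h)) (at x)"
    if "x \<in> interior (convex hull V)" for x
    using Dq(2)[OF that]
    by (subst has_derivative_componentwise_within)
      (auto simp: Basis_vec_def inner_axis matrix_vector_mul_component)
  ultimately show ?thesis using that by blast
qed

section \<open>Vector space structure and dimension of the discrete spaces\<close>

lemma continuous_M_h: "p \<in> M_h Tr \<Omega> \<Longrightarrow> continuous_on (closure \<Omega>) p"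
  by (simp add: M_h_def Lagrange_space_def)

lemma continuous_X_h: "v \<in> X_h Tr \<Omega> \<Longrightarrow> continuous_on (closure \<Omega>) v"
  using continuous_on_vec_lambda[of "closure \<Omega>" "\<lambda>i x. v x $ i"]
  by (simp add: X_h_def Lagrange_space_def)

lemma subspace_M_h: "subspace (M_h Tr \<Omega>)"
  unfolding M_h_def by (rule subspace_Lagrange_space)

lemma subspace_X_h: "subspace (X_h Tr \<Omega>)"
proof (rule subspaceI)
  note L = subspace_Lagrange_space[of 2 Tr "closure \<Omega>"]
  show "0 \<in> X_h Tr \<Omega>"
    using subspace_0[OF L] by (auto simp: X_h_def zero_fun_def)
  show "v + w \<in> X_h Tr \<Omega>" if "v \<in> X_h Tr \<Omega>" "w \<in> X_h Tr \<Omega>" for v w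
    using that subspace_add[OF L] by (auto simp: X_h_def plus_fun_def)
  show "c *\<^sub>R v \<in> X_h Tr \<Omega>" if "v \<in> X_h Tr \<Omega>" for c v
    using that subspace_scale[OF L] by (auto simp: X_h_def scaleR_fun_def)
qed

lemma V_h_X_h: "v \<in> V_h Tr \<Omega> \<Longrightarrow> v \<in> X_h Tr \<Omega>"
  by (simp add: V_h_def)

lemma continuous_rigid_motion: "continuous_on S (rigid_motion a b)"
proof -
  have "continuous_on S (\<lambda>x. (\<chi> i. if i = 1 then - (x$2) else x$1) :: real^2)"
  proof (rule continuous_on_vec_lambda)
    show "continuous_on S (\<lambda>x::real^2. if i = 1 then - (x$2) else x$1)" for i :: 2
      by (cases "i = 1") (auto intro!: continuous_intros)
  qed
  then show ?thesis
    unfolding rigid_motion_def by (intro continuous_on_add continuous_on_const continuous_on_scaleR)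
qed

text \<open>Additivity of the orthogonality constraint rests on integrability, which holds since
  both factors are bounded on \<Omega>.\<close>

lemma subspace_V_h: "subspace (V_h Tr \<Omega>)"
proof (rule subspaceI)
  have int: "integrable (lebesgue_on \<Omega>) (\<lambda>x. v x \<bullet> rigid_motion a b x)" if "v \<in> X_h Tr \<Omega>" for v a b
    using that by (intro ess_bounded_integrable finite_measure_domain ess_bounded_inner
        ess_bounded_continuous continuous_X_h continuous_rigid_motion)
  show "0 \<in> V_h Tr \<Omega>"
    using subspace_0[OF subspace_X_h] by (simp add: V_h_def dom_int_def)
  show "v + w \<in> V_h Tr \<Omega>" if "v \<in> V_h Tr \<Omega>" "w \<in> V_h Tr \<Omega>" for v w
    using that subspace_add[OF subspace_X_h] int
    by (simp add: V_h_def dom_int_def inner_add_left)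
  show "c *\<^sub>R v \<in> V_h Tr \<Omega>" if "v \<in> V_h Tr \<Omega>" for c v
    using that subspace_scale[OF subspace_X_h] by (simp add: V_h_def dom_int_def)
qed

lemma finite_dim_Lagrange_space: "finite_dim (Lagrange_space k Tr (closure \<Omega>))"
  unfolding finite_dim_def
  using Lagrange_space_finite_dim[OF finite_Tr] cells_cover by blast

lemma finite_dim_X_h: "finite_dim (X_h Tr \<Omega>)"
proof -
  define f where "f i p = (\<lambda>x. axis i (p x))" for i :: 2 and p :: "real^2 \<Rightarrow> real"
  let ?L = "Lagrange_space 2 Tr (closure \<Omega>)"
  have "linear (f i)" for i
    by (rule linearI) (auto simp: f_def fun_eq_iff vec_eq_iff axis_def)
  then have "finite_dim (f i ` ?L)" for i
    by (rule finite_dim_linear_image) (rule finite_dim_Lagrange_space)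
  then have "finite_dim {s + t | s t. s \<in> f 1 ` ?L \<and> t \<in> f 2 ` ?L}"
    by (intro finite_dim_sums)
  moreover have "v \<in> {s + t | s t. s \<in> f 1 ` ?L \<and> t \<in> f 2 ` ?L}" if "v \<in> X_h Tr \<Omega>" for v
  proof -
    have "v = f 1 (\<lambda>x. v x $ 1) + f 2 (\<lambda>x. v x $ 2)"
      by (auto simp: f_def fun_eq_iff vec_eq_iff axis_def forall_2)
    then show ?thesis using that unfolding X_h_def by blast
  qed
  ultimately show ?thesis by (blast intro: finite_dim_subset)
qed

lemma finite_dim_discrete_space: "finite_dim (V_h Tr \<Omega> \<times> M_h Tr \<Omega> \<times> M_h Tr \<Omega>)"
  using V_h_X_h unfolding M_h_def
  by (intro finite_dim_Times finite_dim_Lagrange_space finite_dim_subset[OF finite_dim_X_h]) auto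

section \<open>Gradient and strain inside the cells\<close>

lemma grad_M_h_linear:
  assumes "p \<in> M_h Tr \<Omega>" "x \<in> cell_interiors"
  shows "q \<in> M_h Tr \<Omega> \<Longrightarrow> grad (p + q) x = grad p x + grad q x"
    and "grad (c *\<^sub>R p) x = c *\<^sub>R grad p x"
proof -
  obtain V where V: "V \<in> Tr" "x \<in> interior (convex hull V)"
    using assms(2) by (auto simp: cell_interiors_def)
  obtain d where d: "(p has_derivative (\<lambda>h. d \<bullet> h)) (at x)"
    using assms(1) V Lagrange_space_on_cell unfolding M_h_def by blast
  show "grad (p + q) x = grad p x + grad q x" if q: "q \<in> M_h Tr \<Omega>"
  proof -
    obtain e where e: "(q has_derivative (\<lambda>h. e \<bullet> h)) (at x)"
      using q V Lagrange_space_on_cell unfolding M_h_def by blast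
    have "(p + q has_derivative (\<lambda>h. (d + e) \<bullet> h)) (at x)"
      using has_derivative_add[OF d e] by (simp add: plus_fun_def inner_add_left)
    then show ?thesis using d e by (simp add: grad_eq)
  qed
  have "(c *\<^sub>R p has_derivative (\<lambda>h. (c *\<^sub>R d) \<bullet> h)) (at x)"
    using has_derivative_scaleR_right[OF d, of c] by (simp add: scaleR_fun_def)
  then show "grad (c *\<^sub>R p) x = c *\<^sub>R grad p x"
    using d by (simp add: grad_eq)
qed

lemma jac_X_h_linear:
  assumes "v \<in> X_h Tr \<Omega>" "x \<in> cell_interiors"
  shows "w \<in> X_h Tr \<Omega> \<Longrightarrow> jac (v + w) x = jac v x + jac w x"
    and "jac (c *\<^sub>R v) x = c *\<^sub>R jac v x"
proof -
  obtain V where V: "V \<in> Tr" "x \<in> interior (convex hull V)"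
    using assms(2) by (auto simp: cell_interiors_def)
  obtain d where d: "(v has_derivative (\<lambda>h. d *v h)) (at x)"
    using assms(1) V X_h_on_cell by blast
  show "jac (v + w) x = jac v x + jac w x" if w: "w \<in> X_h Tr \<Omega>"
  proof -
    obtain e where e: "(w has_derivative (\<lambda>h. e *v h)) (at x)"
      using w V X_h_on_cell by blast
    have "(v + w has_derivative (\<lambda>h. (d + e) *v h)) (at x)"
      using has_derivative_add[OF d e] by (simp add: plus_fun_def matrix_vector_mult_add_rdistrib)
    then show ?thesis using d e by (simp add: jac_eq)
  qed
  have "(c *\<^sub>R v has_derivative (\<lambda>h. (c *\<^sub>R d) *v h)) (at x)"
    using has_derivative_scaleR_right[OF d, of c]
    by (simp add: scaleR_fun_def scaleR_matrix_vector_assoc)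
  then show "jac (c *\<^sub>R v) x = c *\<^sub>R jac v x"
    using d by (simp add: jac_eq)
qed

lemma strain_X_h_linear:
  assumes "v \<in> X_h Tr \<Omega>" "x \<in> cell_interiors"
  shows "w \<in> X_h Tr \<Omega> \<Longrightarrow> strain (v + w) x = strain v x + strain w x"
    and "strain (c *\<^sub>R v) x = c *\<^sub>R strain v x"
  by (simp_all add: strain_def jac_X_h_linear[OF assms] vec_eq_iff transpose_def field_simps)

lemma ess_bounded_grad:
  assumes "p \<in> M_h Tr \<Omega>"
  shows "ess_bounded (lebesgue_on \<Omega>) (grad p)"
proof (rule ess_bounded_piecewise)
  fix V assume "V \<in> Tr"
  then obtain Dq where "continuous_on UNIV Dq" "\<And>x. x \<in> interior (convex hull V) \<Longrightarrow>
      (p has_derivative (\<lambda>h. Dq x \<bullet> h)) (at x)"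
    using Lagrange_space_on_cell assms unfolding M_h_def by blast
  then show "\<exists>q. continuous_on UNIV q \<and> (\<forall>x\<in>interior (convex hull V). grad p x = q x)"
    using grad_eq by blast
qed

lemma strain_on_cell:
  assumes "v \<in> X_h Tr \<Omega>" "V \<in> Tr"
  shows "\<exists>q. continuous_on UNIV q \<and> (\<forall>x\<in>interior (convex hull V). strain v x = q x)"
proof -
  obtain J where J: "continuous_on UNIV J"
    "\<And>x. x \<in> interior (convex hull V) \<Longrightarrow> (v has_derivative (\<lambda>h. J x *v h)) (at x)"
    using X_h_on_cell[OF assms] by blast
  have "continuous_on UNIV (\<lambda>x. (1/2) *\<^sub>R (J x + transpose (J x)))"
    unfolding transpose_def
    by (intro continuous_intros continuous_on_vec_lambda J(1))
  then show ?thesis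
    by (intro exI[of _ "\<lambda>x. (1/2) *\<^sub>R (J x + transpose (J x))"])
      (simp add: strain_def jac_eq[OF J(2)])
qed

lemma ess_bounded_strain: "v \<in> X_h Tr \<Omega> \<Longrightarrow> ess_bounded (lebesgue_on \<Omega>) (strain v)"
  by (intro ess_bounded_piecewise strain_on_cell)

end

section \<open>Fields with vanishing strain\<close>

text \<open>For a skew matrix \<open>(J *v d) \<bullet> d = 0\<close>. With \<open>d = x - y\<close>
  this is the derivative of the tangential component \<open>v \<bullet> d\<close> along the segment
  from \<open>y\<close> to \<open>x\<close>, which is therefore constant.\<close>

lemma skew_derivative_orthogonal:
  fixes v :: "real^'n \<Rightarrow> real^'n"
  assumes "convex U"
    and der: "\<And>x. x \<in> U \<Longrightarrow> (v has_derivative (\<lambda>h. J x *v h)) (at x)"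
    and skew: "\<And>x. x \<in> U \<Longrightarrow> J x + transpose (J x) = 0"
    and xy: "x \<in> U" "y \<in> U"
  shows "(v x - v y) \<bullet> (x - y) = 0"
proof -
  define d where "d = x - y"
  have Jd: "(J z *v d) \<bullet> d = 0" if "z \<in> U" for z
  proof -
    have "(transpose (J z) *v d) \<bullet> d = d \<bullet> (J z *v d)"
      unfolding transpose_matrix_vector by (rule dot_lmul_matrix)
    moreover have "((J z + transpose (J z)) *v d) \<bullet> d = 0"
      using skew[OF that] by simp
    then have "(J z *v d) \<bullet> d + (transpose (J z) *v d) \<bullet> d = 0"
      unfolding matrix_vector_mult_add_rdistrib inner_add_left .
    ultimately show ?thesis by (simp add: inner_commute)
  qed
  have in_U: "y + t *\<^sub>R d \<in> U" if "t \<in> {0..1}" for t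
  proof -
    have "y + t *\<^sub>R d = (1 - t) *\<^sub>R y + t *\<^sub>R x" by (simp add: d_def algebra_simps)
    then show ?thesis using that convexD_alt[OF assms(1) xy(2,1), of t] by simp
  qed
  have "\<exists>c. \<forall>t\<in>{0..1}. v (y + t *\<^sub>R d) \<bullet> d = c"
  proof (rule has_derivative_zero_constant)
    fix t :: real assume t: "t \<in> {0..1}"
    have "((\<lambda>t. y + t *\<^sub>R d) has_derivative (\<lambda>s. s *\<^sub>R d)) (at t within {0..1})"
      by (auto intro!: derivative_eq_intros)
    then have "((\<lambda>t. v (y + t *\<^sub>R d)) has_derivative (\<lambda>s. J (y + t *\<^sub>R d) *v (s *\<^sub>R d))) (at t within {0..1})"
      using der[OF in_U[OF t]]
      by (rule has_derivative_compose[of "\<lambda>t. y + t *\<^sub>R d" _ _ _ v "\<lambda>h. J (y + t *\<^sub>R d) *v h"])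
    then have "((\<lambda>t. v (y + t *\<^sub>R d) \<bullet> d) has_derivative
        (\<lambda>s. (J (y + t *\<^sub>R d) *v (s *\<^sub>R d)) \<bullet> d)) (at t within {0..1})"
      by (rule has_derivative_inner_left)
    then show "((\<lambda>t. v (y + t *\<^sub>R d) \<bullet> d) has_derivative (\<lambda>h. 0)) (at t within {0..1})"
      using Jd[OF in_U[OF t]] by (simp add: matrix_vector_mult_scaleR)
  qed simp
  then obtain c where c: "\<And>t. t \<in> {0..1} \<Longrightarrow> v (y + t *\<^sub>R d) \<bullet> d = c" by blast
  have "v (y + 0 *\<^sub>R d) \<bullet> d = v (y + 1 *\<^sub>R d) \<bullet> d" using c[of 0] c[of 1] by simp
  then show ?thesis by (simp add: d_def inner_diff_left)
qed

text \<open>Increments are compared with \<open>c\<close> and with two points displaced from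
  \<open>c\<close> along the axes. Subtracting the equation for \<open>c\<close> from each of the
  other two isolates one component of \<open>v x\<close>.\<close>

lemma rigid_motion_if_orthogonal:
  fixes v :: "real^2 \<Rightarrow> real^2"
  assumes "open S" "c \<in> S"
    and orth: "\<And>x y. x \<in> S \<Longrightarrow> y \<in> S \<Longrightarrow> (v x - v y) \<bullet> (x - y) = 0"
  shows "\<exists>a b. \<forall>x\<in>S. v x = rigid_motion a b x"
proof -
  obtain r where r: "r > 0" "cball c r \<subseteq> S" using assms open_contains_cball by blast
  define p q :: "real^2" where "p = c + r *\<^sub>R axis 1 1" and "q = c + r *\<^sub>R axis 2 1"
  have pq: "p \<in> S" "q \<in> S"
    using r by (auto simp: p_def q_def dist_norm intro!: subsetD[OF r(2)])
  have coord: "p$1 = c$1 + r" "p$2 = c$2" "q$1 = c$1" "q$2 = c$2 + r"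
    by (simp_all add: p_def q_def axis_def)
  note dot = inner_vec_def sum_2 inner_real_def
  have vp1: "v p $ 1 = v c $ 1" using orth[OF pq(1) assms(2)] r by (simp add: dot coord)
  have vq2: "v q $ 2 = v c $ 2" using orth[OF pq(2) assms(2)] r by (simp add: dot coord)
  \<comment> \<open>The rotation rate, read off at \<open>p\<close>; orthogonality between
    \<open>p\<close> and \<open>q\<close> then forces the rate \<open>- b\<close> in the first
    component at \<open>q\<close>.\<close>
  define b where "b = (v p $ 2 - v c $ 2) / r"
  have vp2: "v p $ 2 = v c $ 2 + b * r" using r by (simp add: b_def)
  have "(v p $ 1 - v q $ 1) * r - (v p $ 2 - v q $ 2) * r = 0"
    using orth[OF pq] by (simp add: dot coord algebra_simps)
  then have "(v p $ 1 - v q $ 1) - (v p $ 2 - v q $ 2) = 0"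
    using r by (metis left_diff_distrib mult_eq_0_iff less_irrefl)
  then have vq1: "v q $ 1 = v c $ 1 - b * r" using vp1 vp2 vq2 by simp
  \<comment> \<open>The translation part is chosen so that the motion takes the value
    \<open>v c\<close> at \<open>c\<close>.\<close>
  have "v x = rigid_motion (v c - b *\<^sub>R (\<chi> i. if i = 1 then - (c$2) else c$1)) b x" if x: "x \<in> S" for x
  proof -
    have 0: "(v x $ 1 - v c $ 1) * (x$1 - c$1) + (v x $ 2 - v c $ 2) * (x$2 - c$2) = 0"
      using orth[OF x assms(2)] by (simp add: dot)
    have "(v x $ 1 - v c $ 1) * (x$1 - (c$1 + r)) + (v x $ 2 - (v c $ 2 + b * r)) * (x$2 - c$2) = 0"
      using orth[OF x pq(1)] by (simp add: dot coord vp1 vp2)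
    with 0 have "r * (v x $ 1 - v c $ 1 + b * (x$2 - c$2)) = 0" by (simp add: algebra_simps)
    then have 1: "v x $ 1 = v c $ 1 - b * (x$2 - c$2)" using r by simp
    have "(v x $ 1 - (v c $ 1 - b * r)) * (x$1 - c$1) + (v x $ 2 - v c $ 2) * (x$2 - (c$2 + r)) = 0"
      using orth[OF x pq(2)] by (simp add: dot coord vq1 vq2)
    with 0 have "r * (v x $ 2 - v c $ 2 - b * (x$1 - c$1)) = 0" by (simp add: algebra_simps)
    then have 2: "v x $ 2 = v c $ 2 + b * (x$1 - c$1)" using r by simp
    show ?thesis
      by (simp add: vec_eq_iff forall_2 rigid_motion_def 1 2 algebra_simps)
  qed
  then show ?thesis by blast
qed

section \<open>Definiteness of the strain on the discrete displacements\<close>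

context triangulated_domain
begin

text \<open>Discrete functions are fixed to be zero outside the closed domain, so vanishing on the
  closure is already equality of functions; continuity leads there from almost every point of
  \<Omega>.\<close>

lemma AE_zero_imp_zero:
  fixes h :: "real^2 \<Rightarrow> 'b::real_normed_vector"
  assumes cont: "continuous_on (closure \<Omega>) h" and out: "\<And>x. x \<notin> closure \<Omega> \<Longrightarrow> h x = 0"
    and AE: "AE x in lebesgue_on \<Omega>. h x = 0"
  shows "h = 0"
proof
  fix x
  have "h y = 0" if "y \<in> \<Omega>" for y
    using AE_continuous_zero[OF open_domain order_refl sets_domain _ AE that]
      continuous_on_subset[OF cont closure_subset] by blast
  then have "h y = 0" if "y \<in> closure \<Omega>" for y
    using continuous_constant_on_closure[OF cont _ that, of 0] by blast
  then show "h x = 0 x" using out by (cases "x \<in> closure \<Omega>") auto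
qed

lemma M_h_AE_zero:
  assumes "p \<in> M_h Tr \<Omega>" "AE x in lebesgue_on \<Omega>. p x = 0"
  shows "p = 0"
  using assms by (intro AE_zero_imp_zero continuous_M_h) (auto simp: M_h_def Lagrange_space_def)

text \<open>Inside the cell the strain is continuous, so it vanishes everywhere and the Jacobian is
  skew. Both points are then moved to the closed cell by continuity, since closed cells are what
  covers a segment of the domain.\<close>

lemma strain_zero_on_cell:
  assumes v: "v \<in> X_h Tr \<Omega>" and 0: "AE x in lebesgue_on \<Omega>. strain v x = 0"
    and V: "V \<in> Tr" and xy: "x \<in> convex hull V" "y \<in> convex hull V"
  shows "(v x - v y) \<bullet> (x - y) = 0"
proof -
  let ?I = "interior (convex hull V)"
  obtain q where q: "continuous_on UNIV q" "\<And>x. x \<in> ?I \<Longrightarrow> strain v x = q x"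
    using strain_on_cell[OF v V] by blast
  have "continuous_on ?I (strain v)"
    using continuous_on_subset[OF q(1)] q(2) by (simp cong: continuous_on_cong)
  then have s0: "strain v x = 0" if "x \<in> ?I" for x
    using AE_continuous_zero[OF open_interior interior_cell_subset[OF V] sets_domain _ 0 that] by blast
  obtain J where J: "\<And>x. x \<in> ?I \<Longrightarrow> (v has_derivative (\<lambda>h. J x *v h)) (at x)"
    using X_h_on_cell[OF v V] by blast
  have "J x + transpose (J x) = 0" if "x \<in> ?I" for x
    using s0[OF that] jac_eq[OF J[OF that]] by (simp add: strain_def)
  then have int: "(v x - v y) \<bullet> (x - y) = 0" if "x \<in> ?I" "y \<in> ?I" for x y
    using skew_derivative_orthogonal[OF _ J _ that] convex_interior[OF convex_convex_hull] by blast
  let ?f = "\<lambda>p. (v (fst p) - v (snd p)) \<bullet> (fst p - snd p)"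
  have cl: "closure (?I \<times> ?I) = (convex hull V) \<times> (convex hull V)"
    by (simp add: closure_Times closure_interior_cell[OF V])
  have "convex hull V \<subseteq> closure \<Omega>" using V cells_cover by blast
  then have vc: "continuous_on (convex hull V) v"
    using continuous_X_h[OF v] continuous_on_subset by blast
  have "continuous_on ((convex hull V) \<times> (convex hull V)) ?f"
    by (intro continuous_intros continuous_on_compose2[OF vc]) auto
  then have "?f (x, y) = 0"
    using continuous_constant_on_closure[of "?I \<times> ?I" ?f 0 "(x, y)"] int xy unfolding cl by force
  then show ?thesis by simp
qed

text \<open>Along a segment the tangential component of \<open>v\<close> is constant on each cell, so it takes finitely many
  values and, being continuous, only one.\<close>

lemma strain_zero_on_domain:
  assumes v: "v \<in> X_h Tr \<Omega>" and 0: "AE x in lebesgue_on \<Omega>. strain v x = 0"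
    and xy: "x \<in> closure \<Omega>" "y \<in> closure \<Omega>"
  shows "(v x - v y) \<bullet> (x - y) = 0"
proof -
  define z where "z t = y + t *\<^sub>R (x - y)" for t
  define g where "g t = v (z t) \<bullet> (x - y)" for t
  have z: "z t \<in> closure \<Omega>" if "t \<in> {0..1}" for t
  proof -
    have "z t = (1 - t) *\<^sub>R y + t *\<^sub>R x" by (simp add: z_def algebra_simps)
    then show ?thesis
      using that convexD_alt[OF convex_closure[OF convex_domain] xy(2,1), of t] by simp
  qed
  have "continuous_on {0..1} z" unfolding z_def by (intro continuous_intros)
  then have "continuous_on {0..1} g"
    unfolding g_def using z
    by (intro continuous_intros continuous_on_compose2[OF continuous_X_h[OF v]]) auto
  then have conn: "connected (g ` {0..1})" by (rule connected_continuous_image) simp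
  \<comment> \<open>Two points of the line differ by \<open>s - t\<close> times its direction; the
    factor cancels unless \<open>s = t\<close>.\<close>
  have same: "g s = g t" if V: "V \<in> Tr" "z s \<in> convex hull V" "z t \<in> convex hull V" for V s t
  proof -
    have "z s - z t = (s - t) *\<^sub>R (x - y)" by (simp add: z_def algebra_simps)
    then have "(s - t) * (g s - g t) = 0"
      using strain_zero_on_cell[OF v 0 V] by (simp add: g_def inner_diff_left)
    then show ?thesis by auto
  qed
  have "finite (g ` {t \<in> {0..1}. z t \<in> convex hull V})" if "V \<in> Tr" for V
  proof (cases "\<exists>t. z t \<in> convex hull V")
    case True
    then obtain t where t: "z t \<in> convex hull V" by blast
    have "g ` {t \<in> {0..1}. z t \<in> convex hull V} \<subseteq> {g t}"
      using same[OF \<open>V \<in> Tr\<close> _ t] by blast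
    then show ?thesis by (rule finite_subset) simp
  qed simp
  then have "finite (\<Union>V\<in>Tr. g ` {t \<in> {0..1}. z t \<in> convex hull V})" using finite_Tr by blast
  moreover have "g ` {0..1} \<subseteq> (\<Union>V\<in>Tr. g ` {t \<in> {0..1}. z t \<in> convex hull V})"
    using z unfolding cells_cover[symmetric] by blast
  ultimately have "finite (g ` {0..1})" using finite_subset by blast
  then obtain a where "g ` {0..1} = {a}" using connected_finite_iff_sing[OF conn] by auto
  then have "g 0 = g 1" by (metis atLeastAtMost_iff imageI order_refl singletonD zero_le_one)
  then show ?thesis by (simp add: g_def z_def inner_diff_left)
qed

text \<open>On \<Omega> the field coincides with a rigid motion, and membership in
  \<open>V_h\<close> makes it orthogonal to that very motion, so its squared norm integrates to
  zero.\<close>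

lemma V_h_strain_zero:
  assumes v: "v \<in> V_h Tr \<Omega>" and 0: "AE x in lebesgue_on \<Omega>. strain v x = 0"
  shows "v = 0"
proof -
  note X = V_h_X_h[OF v]
  obtain c where "c \<in> \<Omega>" using nonempty_domain by blast
  then obtain a b where ab: "\<And>x. x \<in> \<Omega> \<Longrightarrow> v x = rigid_motion a b x"
    using rigid_motion_if_orthogonal[OF open_domain, of c v] strain_zero_on_domain[OF X 0] closure_subset
    by blast
  have "(\<integral>x. v x \<bullet> v x \<partial>lebesgue_on \<Omega>) = (\<integral>x. v x \<bullet> rigid_motion a b x \<partial>lebesgue_on \<Omega>)"
    using ab by (intro Bochner_Integration.integral_cong) auto
  also have "\<dots> = 0" using v by (simp add: V_h_def dom_int_def)
  finally have "(\<integral>x. v x \<bullet> v x \<partial>lebesgue_on \<Omega>) = 0" .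
  moreover have "integrable (lebesgue_on \<Omega>) (\<lambda>x. v x \<bullet> v x)"
    using X by (intro ess_bounded_integrable finite_measure_domain ess_bounded_inner
        ess_bounded_continuous continuous_X_h)
  ultimately have "AE x in lebesgue_on \<Omega>. v x \<bullet> v x = 0"
    using integral_nonneg_eq_0_iff_AE[of "lebesgue_on \<Omega>" "\<lambda>x. v x \<bullet> v x"] by simp
  then have "AE x in lebesgue_on \<Omega>. v x = 0" by simp
  moreover have "v x = 0" if "x \<notin> closure \<Omega>" for x
    using X that by (simp add: X_h_def Lagrange_space_def vec_eq_iff)
  ultimately show ?thesis using AE_zero_imp_zero[OF continuous_X_h[OF X]] by blast
qed

end

section \<open>The flux of the discrete system\<close>

text \<open>With a bound \<open>B\<close> for \<open>v\<close> the integrand is dominated by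
  \<open>norm (f x) * B\<close>, hence by \<open>(norm (f x))^2 + B^2\<close>, where the constant is
  integrable because the measure is finite.\<close>

lemma integrable_L2_inner:
  fixes f v :: "'a \<Rightarrow> 'b::euclidean_space"
  assumes M: "finite_measure M" and f: "f \<in> borel_measurable M" "integrable M (\<lambda>x. (norm (f x))\<^sup>2)"
    and v: "ess_bounded M v"
  shows "integrable M (\<lambda>x. f x \<bullet> v x)"
proof -
  obtain B where B: "v \<in> borel_measurable M" "B \<ge> 0" "AE x in M. norm (v x) \<le> B"
    using v by (rule ess_boundedE)
  have "integrable M (\<lambda>x. (norm (f x))\<^sup>2 + B\<^sup>2)"
    using M f by (intro Bochner_Integration.integrable_add finite_measure.integrable_const)
  then show ?thesis
  proof (rule Bochner_Integration.integrable_bound)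
    show "(\<lambda>x. f x \<bullet> v x) \<in> borel_measurable M" using f B by (intro borel_measurable_inner)
    show "AE x in M. norm (f x \<bullet> v x) \<le> norm ((norm (f x))\<^sup>2 + B\<^sup>2)"
      using B(3)
    proof eventually_elim
      case (elim x)
      have "\<bar>f x \<bullet> v x\<bar> \<le> norm (f x) * norm (v x)" by (rule Cauchy_Schwarz_ineq2)
      also have "\<dots> \<le> norm (f x) * B" using elim by (intro mult_left_mono) auto
      also have "\<dots> \<le> 2 * norm (f x) * B" using B(2) by simp
      also have "\<dots> \<le> (norm (f x))\<^sup>2 + B\<^sup>2" by (rule sum_squares_bound)
      finally show ?case by simp
    qed
  qed
qed

lemma ess_bounded_continuous_compose:
  fixes f :: "'a \<Rightarrow> 'b::euclidean_space" and N :: "'b \<Rightarrow> 'c::euclidean_space"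
  assumes N: "continuous_on UNIV N" and f: "ess_bounded M f"
  shows "ess_bounded M (\<lambda>x. N (f x))"
proof -
  obtain B where B: "f \<in> borel_measurable M" "AE x in M. norm (f x) \<le> B"
    using f by (rule ess_boundedE)
  have "bounded (N ` cball 0 B)"
    using continuous_on_subset[OF N]
    by (intro compact_imp_bounded compact_continuous_image) auto
  then obtain C where C: "\<And>y. y \<in> cball 0 B \<Longrightarrow> norm (N y) \<le> C"
    unfolding bounded_iff by blast
  have "AE x in M. norm (N (f x)) \<le> C" using B(2) by eventually_elim (use C in auto)
  moreover have "(\<lambda>x. N (f x)) \<in> borel_measurable M"
    using measurable_compose[OF B(1) borel_measurable_continuous_onI[OF N]] .
  ultimately show ?thesis by (intro ess_boundedI)
qed

text \<open>Turns the pressure stress \<open>s *\<^sub>R mat 1\<close> paired with a strain into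
  \<open>s\<close> times a divergence, and lets Cauchy-Schwarz bound the trace.\<close>

lemma mat_1_inner: "(mat 1 :: real^'n^'n) \<bullet> A = trace A"
proof -
  have "(mat 1 :: real^'n^'n) \<bullet> A = (\<Sum>i\<in>UNIV. \<Sum>j\<in>UNIV. (if i = j then 1 else 0) * A $ i $ j)"
    by (simp add: inner_vec_def mat_def)
  also have "\<dots> = (\<Sum>i\<in>UNIV. \<Sum>j\<in>UNIV. if i = j then A $ i $ j else 0)"
    by (intro sum.cong) auto
  also have "\<dots> = trace A" by (simp add: trace_def)
  finally show ?thesis .
qed

text \<open>The permeability is bounded as a quadratic form, whereas the Lipschitz estimate needs a
  bound on vectors. Polarisation connects them, applied to \<open>z\<close> and the vector
  \<open>w\<close> in the direction of \<open>A *v z\<close> with the length of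
  \<open>z\<close>.\<close>

lemma symmetric_form_norm_bound:
  fixes A :: "real^'n^'n"
  assumes sym: "transpose A = A"
    and A: "\<And>z. 0 \<le> (A *v z) \<bullet> z" "\<And>z. (A *v z) \<bullet> z \<le> B * (norm z)\<^sup>2"
  shows "norm (A *v z) \<le> B * norm z"
proof (cases "A *v z = 0")
  case True
  have "0 \<le> B * (norm z)\<^sup>2" using A order_trans by blast
  then have "0 \<le> B * norm z" by (cases "z = 0") (auto simp: zero_le_mult_iff)
  then show ?thesis using True by simp
next
  case False
  then have z: "z \<noteq> 0" by auto
  define w where "w = (norm z / norm (A *v z)) *\<^sub>R (A *v z)"
  have w: "norm w = norm z" using False by (simp add: w_def)
  have "(A *v w) \<bullet> z = w \<bullet> (A *v z)"
    using dot_lmul_matrix[of w A z] transpose_matrix_vector[of A w] sym by simp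
  then have "4 * (w \<bullet> (A *v z)) = (A *v (z + w)) \<bullet> (z + w) - (A *v (z - w)) \<bullet> (z - w)"
    by (simp add: matrix_vector_right_distrib matrix_vector_mult_diff_distrib
        inner_add_left inner_add_right inner_diff_left inner_diff_right inner_commute)
  also have "\<dots> \<le> B * (norm (z + w))\<^sup>2" using A(2)[of "z + w"] A(1)[of "z - w"] by linarith
  also have "\<dots> \<le> B * (2 * norm z)\<^sup>2"
  proof (intro mult_left_mono power_mono)
    show "norm (z + w) \<le> 2 * norm z" using norm_triangle_ineq[of z w] w by simp
    have "0 \<le> B * (norm z)\<^sup>2" using A order_trans by blast
    then show "0 \<le> B" using z by (simp add: zero_le_mult_iff)
  qed simp
  finally have "w \<bullet> (A *v z) \<le> B * (norm z)\<^sup>2" by (simp add: power_mult_distrib)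
  moreover have "w \<bullet> (A *v z) = norm z * norm (A *v z)"
    using False by (simp add: w_def dot_square_norm power2_eq_square)
  ultimately have "norm z * norm (A *v z) \<le> norm z * (B * norm z)"
    by (simp add: power2_eq_square algebra_simps)
  then show ?thesis using z by simp
qed

text \<open>In the explicit case \<open>\<theta> = 0\<close> the flow equation is only coupled one way, and coercivity is obtained by
  giving it a small weight \<open>\<delta>\<close>.\<close>

lemma coupling_coercive:
  fixes k1 k2 k3 :: real and \<theta> :: nat
  assumes "k1 > 0" "k2 > 0" "k3 > 0"
  shows "\<exists>\<delta>>0. \<exists>\<gamma>>0. \<forall>s t. \<gamma> * (s\<^sup>2 + t\<^sup>2) \<le>
    k3 * s\<^sup>2 - k1 * (if \<theta> = 0 then 0 else (t - k1 * s) / k2) * s + \<delta> * ((t - k1 * s) / k2) * t"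
proof (cases "\<theta> = 0")
  case True
  \<comment> \<open>This weight turns the form into
    \<open>k3 * s^2 - (k3 / k1) * s * t + (k3 / k1^2) * t^2\<close>, which is \<open>k3 / 2\<close>
    times the sum of \<open>s^2\<close>, \<open>(t / k1)^2\<close> and
    \<open>(s - t / k1)^2\<close>.\<close>
  define \<delta> \<gamma> where "\<delta> = k2 * k3 / k1\<^sup>2" and "\<gamma> = min (k3 / 2) (k3 / (2 * k1\<^sup>2))"
  have "\<gamma> * (s\<^sup>2 + t\<^sup>2) \<le> k3 * s\<^sup>2 + \<delta> * ((t - k1 * s) / k2) * t" for s t
  proof -
    have "\<gamma> * (s\<^sup>2 + t\<^sup>2) \<le> (k3 / 2) * s\<^sup>2 + (k3 / (2 * k1\<^sup>2)) * t\<^sup>2"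
      unfolding distrib_left by (intro add_mono mult_right_mono) (auto simp: \<gamma>_def)
    also have "\<dots> \<le> (k3 / 2) * s\<^sup>2 + (k3 / (2 * k1\<^sup>2)) * t\<^sup>2 + k3 / 2 * (s - t / k1)\<^sup>2"
      using assms by simp
    also have "\<dots> = k3 * s\<^sup>2 + \<delta> * ((t - k1 * s) / k2) * t"
      using assms by (simp add: \<delta>_def field_simps power2_eq_square)
    finally show ?thesis .
  qed
  moreover have "\<delta> > 0" "\<gamma> > 0" using assms by (auto simp: \<delta>_def \<gamma>_def)
  ultimately show ?thesis using True by (intro exI[of _ \<delta>] conjI exI[of _ \<gamma>]) auto
next
  case False
  \<comment> \<open>With weight 1 the two couplings combine to
    \<open>k3 * s^2 + (t - k1 * s)^2 / k2\<close>. Estimating \<open>t^2\<close> by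
    \<open>2 * (t - k1 * s)^2 + 2 * k1^2 * s^2\<close> and comparing coefficients gives the two
    entries of the minimum.\<close>
  define \<gamma> where "\<gamma> = min (1 / (2 * k2)) (k3 / (1 + 2 * k1\<^sup>2))"
  have p: "1 + 2 * k1\<^sup>2 > 0" by (simp add: add_pos_nonneg)
  have "\<gamma> > 0" using assms p by (simp add: \<gamma>_def)
  have "\<gamma> \<le> k3 / (1 + 2 * k1\<^sup>2)" by (simp add: \<gamma>_def)
  then have \<gamma>1: "\<gamma> * (1 + 2 * k1\<^sup>2) \<le> k3" using p by (simp add: le_divide_eq)
  have \<gamma>2: "2 * \<gamma> \<le> 1 / k2" using assms by (simp add: \<gamma>_def min_def field_simps)
  have "\<gamma> * (s\<^sup>2 + t\<^sup>2) \<le> k3 * s\<^sup>2 - k1 * ((t - k1 * s) / k2) * s + 1 * ((t - k1 * s) / k2) * t" for s t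
  proof -
    have "t\<^sup>2 \<le> 2 * (t - k1 * s)\<^sup>2 + 2 * k1\<^sup>2 * s\<^sup>2"
    proof -
      have "0 \<le> (t - 2 * (k1 * s))\<^sup>2" by simp
      then show ?thesis by (simp add: power2_eq_square algebra_simps)
    qed
    then have "\<gamma> * (s\<^sup>2 + t\<^sup>2) \<le> \<gamma> * (s\<^sup>2 + (2 * (t - k1 * s)\<^sup>2 + 2 * k1\<^sup>2 * s\<^sup>2))"
      using \<open>\<gamma> > 0\<close> by (intro mult_left_mono add_left_mono) auto
    also have "\<dots> = \<gamma> * (1 + 2 * k1\<^sup>2) * s\<^sup>2 + (2 * \<gamma>) * (t - k1 * s)\<^sup>2"
      by (simp add: algebra_simps)
    also have "\<dots> \<le> k3 * s\<^sup>2 + (1 / k2) * (t - k1 * s)\<^sup>2"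
      using \<gamma>1 \<gamma>2 by (intro add_mono mult_right_mono) auto
    also have "\<dots> = k3 * s\<^sup>2 - k1 * ((t - k1 * s) / k2) * s + 1 * ((t - k1 * s) / k2) * t"
      using assms by (simp add: field_simps power2_eq_square)
    finally show ?thesis .
  qed
  then show ?thesis using False \<open>\<gamma> > 0\<close> by (intro exI[of _ 1] conjI exI[of _ \<gamma>]) auto
qed

text \<open>The fields are \<open>(e, s, t, \<zeta>) = (\<epsilon>(u), \<xi>, p, \<nabla>p)\<close> with \<open>p = \<kappa>\<^sub>1 \<xi> + \<kappa>\<^sub>2 \<eta>\<close>; \<open>y\<close> and \<open>A\<close> are the values of
  \<open>\<eta>\<^sub>h\<^sup>n\<close> and \<open>K\<close> at the point considered.\<close>

definition flux ::
  "(real^2^2 \<Rightarrow> real^2^2) \<Rightarrow> nat \<Rightarrow> real \<Rightarrow> real \<Rightarrow> real \<Rightarrow> real \<Rightarrow> real \<Rightarrow> real^2 \<Rightarrow>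
   real \<Rightarrow> real^2^2 \<Rightarrow> (real^2^2) \<times> real \<times> real \<times> (real^2) \<Rightarrow> (real^2^2) \<times> real \<times> real \<times> (real^2)" where
  "flux N \<theta> k1 k2 k3 \<delta> c g y A = (\<lambda>(e, s, t, \<zeta>).
     (N e - s *\<^sub>R mat 1,
      trace e + k3 * s - k1 * (if \<theta> = 0 then y else (t - k1 * s) / k2),
      \<delta> * ((t - k1 * s) / k2 - y),
      c *\<^sub>R (A *v (\<zeta> - g))))"

text \<open>The data \<open>y\<close> and \<open>g\<close> drop out of differences; in the explicit
  case the whole \<open>\<eta>\<close> term of the second component goes with them.\<close>

lemma flux_diff:
  "flux N \<theta> k1 k2 k3 \<delta> c g y A (e, s, t, z) - flux N \<theta> k1 k2 k3 \<delta> c g y A (e', s', t', z') =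
    (N e - N e' - (s - s') *\<^sub>R mat 1,
     trace (e - e') + k3 * (s - s')
       - k1 * (if \<theta> = 0 then 0 else ((t - t') - k1 * (s - s')) / k2),
     \<delta> * (((t - t') - k1 * (s - s')) / k2),
     c *\<^sub>R (A *v (z - z')))"
proof -
  have \<eta>: "((t - t') - k1 * (s - s')) / k2 = (t - k1 * s) / k2 - (t' - k1 * s') / k2"
    by (simp add: diff_divide_distrib[symmetric] algebra_simps)
  show ?thesis
    unfolding \<eta> by (simp add: flux_def trace_sub algebra_simps)
qed

text \<open>Once the trace terms have cancelled, the pairing splits into three blocks:
  \<open>N\<close> on the strain, the form \<open>coercive\<close> of the coupling in
  \<open>s\<close> and \<open>t\<close>, and \<open>A\<close> on the gradient. The constant is the
  smallest of the three.\<close>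

lemma flux_mono:
  fixes N :: "real^2^2 \<Rightarrow> real^2^2"
  assumes N: "C * (norm (e - e'))\<^sup>2 \<le> (N e - N e') \<bullet> (e - e')"
    and \<gamma>: "\<And>s t. \<gamma> * (s\<^sup>2 + t\<^sup>2) \<le> k3 * s\<^sup>2
      - k1 * (if \<theta> = 0 then 0 else (t - k1 * s) / k2) * s + \<delta> * ((t - k1 * s) / k2) * t"
    and A: "\<And>z. K1 * (norm z)\<^sup>2 \<le> (A *v z) \<bullet> z" and c: "c \<ge> 0"
  shows "min C (min \<gamma> (c * K1)) * (norm ((e, s, t, z) - (e', s', t', z')))\<^sup>2 \<le>
    (flux N \<theta> k1 k2 k3 \<delta> c g y A (e, s, t, z) - flux N \<theta> k1 k2 k3 \<delta> c g y A (e', s', t', z'))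
      \<bullet> ((e, s, t, z) - (e', s', t', z'))"
proof -
  let ?m = "min C (min \<gamma> (c * K1))"
  define E S T' Q where d: "E = e - e'" "S = s - s'" "T' = t - t'" "Q = z - z'"
  have "?m * (norm ((e, s, t, z) - (e', s', t', z')))\<^sup>2
      = ?m * (norm E)\<^sup>2 + ?m * (S\<^sup>2 + T'\<^sup>2) + ?m * (norm Q)\<^sup>2"
    by (simp add: norm_Pair d distrib_left add.assoc)
  also have "\<dots> \<le> C * (norm E)\<^sup>2 + \<gamma> * (S\<^sup>2 + T'\<^sup>2) + c * K1 * (norm Q)\<^sup>2"
    by (intro add_mono mult_right_mono) auto
  also have "\<dots> \<le> (N e - N e') \<bullet> E + (k3 * S\<^sup>2
      - k1 * (if \<theta> = 0 then 0 else (T' - k1 * S) / k2) * S + \<delta> * ((T' - k1 * S) / k2) * T')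
      + c * ((A *v Q) \<bullet> Q)"
    using N \<gamma>[of S T'] mult_left_mono[OF A[of Q] c] by (simp add: d)
  also have "\<dots> = ((N e - N e' - S *\<^sub>R mat 1) \<bullet> E
      + (trace E + k3 * S - k1 * (if \<theta> = 0 then 0 else (T' - k1 * S) / k2)) * S
      + \<delta> * ((T' - k1 * S) / k2) * T' + (c *\<^sub>R (A *v Q)) \<bullet> Q)"
    by (simp add: inner_diff_left mat_1_inner algebra_simps power2_eq_square)
  also have "\<dots> = (flux N \<theta> k1 k2 k3 \<delta> c g y A (e, s, t, z)
      - flux N \<theta> k1 k2 k3 \<delta> c g y A (e', s', t', z')) \<bullet> ((e, s, t, z) - (e', s', t', z'))"
    unfolding flux_diff by (simp add: inner_Pair d)
  finally show ?thesis .
qed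

text \<open>The norm of a tuple is at most the sum of the norms of its components, which are bounded
  separately. \<open>norm (mat 1)\<close> is counted twice, for \<open>s *\<^sub>R mat 1\<close> and
  for the trace; \<open>L\<close> enters by absolute value since its sign is unknown.\<close>

lemma flux_lipschitz:
  fixes N :: "real^2^2 \<Rightarrow> real^2^2"
  assumes N: "norm (N e - N e') \<le> L * norm (e - e')"
    and A: "\<And>z. norm (A *v z) \<le> B * norm z" and B: "B \<ge> 0"
  shows "norm (flux N \<theta> k1 k2 k3 \<delta> c g y A (e, s, t, z) - flux N \<theta> k1 k2 k3 \<delta> c g y A (e', s', t', z'))
    \<le> (\<bar>L\<bar> + 2 * norm (mat 1 :: real^2^2) + \<bar>k3\<bar> + (\<bar>k1\<bar> + \<bar>\<delta>\<bar>) * (1 + \<bar>k1\<bar>) / \<bar>k2\<bar> + \<bar>c\<bar> * B)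
      * norm ((e, s, t, z) - (e', s', t', z'))"
proof -
  define I where "I = norm (mat 1 :: real^2^2)"
  define n where "n = norm ((e, s, t, z) - (e', s', t', z'))"
  define E S T' Q where d: "E = e - e'" "S = s - s'" "T' = t - t'" "Q = z - z'"
  have n: "n = norm (E, S, T', Q)" by (simp add: n_def d)
  have le: "norm E \<le> n" "\<bar>S\<bar> \<le> n" "\<bar>T'\<bar> \<le> n" "norm Q \<le> n"
    using norm_fst_le[of E "(S, T', Q)"] norm_snd_le[of "(S, T', Q)" E]
      norm_fst_le[of S "(T', Q)"] norm_snd_le[of "(T', Q)" S]
      norm_fst_le[of T' Q] norm_snd_le[of Q T'] by (auto simp: n)
  have TS: "\<bar>(T' - k1 * S) / k2\<bar> \<le> (1 + \<bar>k1\<bar>) / \<bar>k2\<bar> * n"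
  proof -
    have "\<bar>T' - k1 * S\<bar> \<le> \<bar>T'\<bar> + \<bar>k1\<bar> * \<bar>S\<bar>" by (metis abs_mult abs_triangle_ineq4)
    also have "\<dots> \<le> n + \<bar>k1\<bar> * n" using le by (intro add_mono mult_left_mono) auto
    finally have "\<bar>T' - k1 * S\<bar> / \<bar>k2\<bar> \<le> (n + \<bar>k1\<bar> * n) / \<bar>k2\<bar>" by (intro divide_right_mono) auto
    then show ?thesis by (simp add: algebra_simps add_divide_distrib)
  qed
  let ?\<eta> = "if \<theta> = 0 then 0 else (T' - k1 * S) / k2"
  have \<eta>: "\<bar>?\<eta>\<bar> \<le> (1 + \<bar>k1\<bar>) / \<bar>k2\<bar> * n"
    using TS by (auto simp: n_def)
  have 1: "norm (N e - N e' - S *\<^sub>R mat 1) \<le> (\<bar>L\<bar> + I) * n"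
  proof -
    have "norm (N e - N e' - S *\<^sub>R mat 1) \<le> norm (N e - N e') + \<bar>S\<bar> * I"
      using norm_triangle_ineq4[of "N e - N e'" "S *\<^sub>R mat 1"] by (simp add: I_def)
    also have "\<dots> \<le> \<bar>L\<bar> * n + n * I"
    proof (intro add_mono mult_right_mono)
      have "norm (N e - N e') \<le> \<bar>L\<bar> * norm E"
        using N by (rule order_trans) (auto intro!: mult_right_mono simp: d)
      also have "\<dots> \<le> \<bar>L\<bar> * n" using le by (intro mult_left_mono) auto
      finally show "norm (N e - N e') \<le> \<bar>L\<bar> * n" .
    qed (use le in \<open>auto simp: I_def\<close>)
    finally show ?thesis by (simp add: algebra_simps)
  qed
  have 2: "\<bar>trace E + k3 * S - k1 * ?\<eta>\<bar> \<le> (I + \<bar>k3\<bar> + \<bar>k1\<bar> * ((1 + \<bar>k1\<bar>) / \<bar>k2\<bar>)) * n"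
  proof -
    have "\<bar>trace E\<bar> \<le> I * norm E"
      unfolding mat_1_inner[symmetric] I_def by (rule Cauchy_Schwarz_ineq2)
    also have "\<dots> \<le> I * n" using le by (intro mult_left_mono) (auto simp: I_def)
    finally have "\<bar>trace E\<bar> \<le> I * n" .
    moreover have "\<bar>k3 * S\<bar> \<le> \<bar>k3\<bar> * n"
      using le by (simp add: abs_mult mult_left_mono)
    moreover have "\<bar>k1 * ?\<eta>\<bar> \<le> \<bar>k1\<bar> * ((1 + \<bar>k1\<bar>) / \<bar>k2\<bar> * n)"
      unfolding abs_mult using \<eta> by (intro mult_left_mono) auto
    ultimately show ?thesis
      unfolding distrib_right mult.assoc by linarith
  qed
  have 3: "\<bar>\<delta> * ((T' - k1 * S) / k2)\<bar> \<le> \<bar>\<delta>\<bar> * ((1 + \<bar>k1\<bar>) / \<bar>k2\<bar>) * n"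
    unfolding abs_mult mult.assoc using TS by (intro mult_left_mono) auto
  have 4: "norm (c *\<^sub>R (A *v Q)) \<le> \<bar>c\<bar> * B * n"
  proof -
    have "norm (A *v Q) \<le> B * n" using A[of Q] mult_left_mono[OF le(4) B] by linarith
    then show ?thesis by (simp add: mult.assoc mult_left_mono)
  qed
  have "norm (flux N \<theta> k1 k2 k3 \<delta> c g y A (e, s, t, z) - flux N \<theta> k1 k2 k3 \<delta> c g y A (e', s', t', z'))
      = norm (N e - N e' - S *\<^sub>R mat 1, trace E + k3 * S - k1 * ?\<eta>,
          \<delta> * ((T' - k1 * S) / k2), c *\<^sub>R (A *v Q))"
    unfolding flux_diff by (simp add: d)
  also have "\<dots> \<le> norm (N e - N e' - S *\<^sub>R mat 1) + (\<bar>trace E + k3 * S - k1 * ?\<eta>\<bar>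
      + (\<bar>\<delta> * ((T' - k1 * S) / k2)\<bar> + norm (c *\<^sub>R (A *v Q))))"
    by (intro order_trans[OF norm_Pair_le] add_mono) (simp_all add: norm_Pair_le)
  also have "\<dots> \<le> (\<bar>L\<bar> + I) * n + ((I + \<bar>k3\<bar> + \<bar>k1\<bar> * ((1 + \<bar>k1\<bar>) / \<bar>k2\<bar>)) * n
      + (\<bar>\<delta>\<bar> * ((1 + \<bar>k1\<bar>) / \<bar>k2\<bar>) * n + \<bar>c\<bar> * B * n))"
    using 1 2 3 4 by (intro add_mono)
  also have "\<dots> = (\<bar>L\<bar> + 2 * I + \<bar>k3\<bar> + (\<bar>k1\<bar> + \<bar>\<delta>\<bar>) * (1 + \<bar>k1\<bar>) / \<bar>k2\<bar> + \<bar>c\<bar> * B) * n"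
    by (simp add: algebra_simps add_divide_distrib)
  finally show ?thesis by (simp add: I_def n_def)
qed

section \<open>Continuity of the stress and boundedness of the composed fields\<close>

text \<open>Supplies measurability and boundedness of the stress along a discrete strain. Continuity
  of \<open>deriv \<Phi>\<close> comes from its differentiability.\<close>

lemma continuous_N_op:
  assumes "\<forall>r. deriv \<Phi> differentiable at r"
  shows "continuous_on UNIV (N_op lam \<kappa> \<mu> \<Phi>)"
proof -
  have tr: "continuous_on UNIV (trace :: real^2^2 \<Rightarrow> real)"
    unfolding trace_def by (intro continuous_intros)
  have "continuous_on UNIV (\<lambda>e::real^2^2. e ** e)"
    unfolding matrix_matrix_mult_def by (intro continuous_on_vec_lambda continuous_intros)
  then have dev: "continuous_on UNIV dev"
    unfolding dev_def
    by (intro continuous_intros tr continuous_on_compose2[OF tr]) auto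
  have "continuous_on UNIV (deriv \<Phi>)"
    using assms by (auto intro!: continuous_at_imp_continuous_on differentiable_imp_continuous_within)
  then have "continuous_on UNIV (\<lambda>e. deriv \<Phi> (dev e))"
    by (rule continuous_on_compose2[OF _ dev]) simp
  then show ?thesis
    unfolding N_op_def sigma_HM_def Let_def divide_inverse
    by (intro continuous_intros tr)
qed

lemma transpose_strain: "transpose (strain v x) = strain v x"
  by (simp add: strain_def vec_eq_iff transpose_def add.commute)

lemma trace_strain: "trace (strain v x) = divg v x"
  by (simp add: strain_def divg_def trace_def transpose_def sum.distrib flip: sum_distrib_left)

lemma strain_zero: "strain 0 x = 0"
  using jac_eq[of 0 0 x] by (simp add: strain_def zero_fun_def transpose_def vec_eq_iff)

lemma grad_zero: "grad 0 x = 0"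
proof -
  have "(\<bullet>) (0::real^2) = (\<lambda>_. 0)" by auto
  then show ?thesis using grad_eq[of 0 0 x] by (simp add: zero_fun_def)
qed

lemma ess_bounded_matrix_vector_mult:
  fixes K :: "'a \<Rightarrow> real^'n^'n"
  assumes K: "K \<in> borel_measurable M" "\<And>x z. x \<in> space M \<Longrightarrow> norm (K x *v z) \<le> B * norm z" "B \<ge> 0"
    and h: "ess_bounded M h"
  shows "ess_bounded M (\<lambda>x. K x *v h x)"
proof -
  obtain C where C: "h \<in> borel_measurable M" "AE x in M. norm (h x) \<le> C"
    using h by (rule ess_boundedE)
  have "continuous_on UNIV (\<lambda>p :: (real^'n^'n) \<times> (real^'n). fst p *v snd p)"
    unfolding matrix_vector_mult_def by (intro continuous_on_vec_lambda continuous_intros)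
  then have "(\<lambda>x. K x *v h x) \<in> borel_measurable M"
    by (rule borel_measurable_continuous_Pair[OF K(1) C(1)])
  moreover have "AE x in M. norm (K x *v h x) \<le> B * C"
    using C(2) AE_space
  proof eventually_elim
    case (elim x)
    have "norm (K x *v h x) \<le> B * norm (h x)" by (rule K(2)[OF elim(2)])
    also have "\<dots> \<le> B * C" using elim(1) K(3) by (rule mult_left_mono)
    finally show ?case .
  qed
  ultimately show ?thesis by (rule ess_boundedI)
qed

definition fields ::
  "(real^2 \<Rightarrow> real^2) \<times> (real^2 \<Rightarrow> real) \<times> (real^2 \<Rightarrow> real) \<Rightarrow>
   real^2 \<Rightarrow> (real^2^2) \<times> real \<times> real \<times> (real^2)" where
  "fields = (\<lambda>(u, \<xi>, p) x. (strain u x, \<xi> x, p x, grad p x))"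

section \<open>Load functionals and the field map\<close>

context triangulated_domain
begin

abbreviation "Z \<equiv> V_h Tr \<Omega> \<times> M_h Tr \<Omega> \<times> M_h Tr \<Omega>"

lemma dom_int_L2_add:
  assumes "L2_dom \<Omega> f" "continuous_on (closure \<Omega>) v" "continuous_on (closure \<Omega>) w"
  shows "dom_int \<Omega> (\<lambda>x. f x \<bullet> (v + w) x) = dom_int \<Omega> (\<lambda>x. f x \<bullet> v x) + dom_int \<Omega> (\<lambda>x. f x \<bullet> w x)"
  using assms unfolding L2_dom_def dom_int_def
  by (simp add: inner_add_right integrable_L2_inner finite_measure_domain ess_bounded_continuous)

lemma dom_int_scale: "dom_int \<Omega> (\<lambda>x. f x \<bullet> (c *\<^sub>R v) x) = c * dom_int \<Omega> (\<lambda>x. f x \<bullet> v x)"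
  by (simp add: dom_int_def)

text \<open>Each side lies in the closed domain, so a continuous \<open>v\<close> is bounded along
  its parametrisation over the unit interval and integrable against the square-integrable
  datum.\<close>

lemma bdry_int_L2_add:
  fixes f v w :: "real^2 \<Rightarrow> 'b::euclidean_space"
  assumes f: "L2_bdry \<Omega> f" and v: "continuous_on (closure \<Omega>) v" and w: "continuous_on (closure \<Omega>) w"
  shows "bdry_int \<Omega> (\<lambda>x. f x \<bullet> (v + w) x) = bdry_int \<Omega> (\<lambda>x. f x \<bullet> v x) + bdry_int \<Omega> (\<lambda>x. f x \<bullet> w x)"
proof -
  let ?I = "lebesgue_on {0..1::real}"
  have I: "finite_measure ?I" by (rule finite_measure_lebesgue_on) simp
  have int: "integrable ?I (\<lambda>t. f (a + t *\<^sub>R (b - a)) \<bullet> q (a + t *\<^sub>R (b - a)))"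
    if ab: "(a, b) \<in> polygon_sides \<Omega>" and q: "continuous_on (closure \<Omega>) q"
    for a b and q :: "real^2 \<Rightarrow> 'b"
  proof -
    have seg: "closed_segment a b \<subseteq> frontier \<Omega>" using ab by (simp add: polygon_sides_def)
    have in_cl: "a + t *\<^sub>R (b - a) \<in> closure \<Omega>" if "t \<in> {0..1}" for t
    proof -
      have "a + t *\<^sub>R (b - a) = (1 - t) *\<^sub>R a + t *\<^sub>R b" by (simp add: algebra_simps)
      then have "a + t *\<^sub>R (b - a) \<in> closed_segment a b" using that by (auto simp: in_segment)
      then show ?thesis using seg by (auto simp: frontier_def)
    qed
    have c: "continuous_on {0..1} (\<lambda>t. q (a + t *\<^sub>R (b - a)))"
      using in_cl by (intro continuous_on_compose2[OF q] continuous_intros) auto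
    then have "(\<lambda>t. q (a + t *\<^sub>R (b - a))) \<in> borel_measurable ?I"
      by (rule continuous_imp_measurable_on_sets_lebesgue) simp
    moreover have "bounded ((\<lambda>t. q (a + t *\<^sub>R (b - a))) ` {0..1})"
      by (intro compact_imp_bounded compact_continuous_image c) simp
    then obtain B where "\<And>t. t \<in> {0..1} \<Longrightarrow> norm (q (a + t *\<^sub>R (b - a))) \<le> B"
      unfolding bounded_iff by blast
    then have "AE t in ?I. norm (q (a + t *\<^sub>R (b - a))) \<le> B" by (intro AE_I2) auto
    ultimately have "ess_bounded ?I (\<lambda>t. q (a + t *\<^sub>R (b - a)))" by (rule ess_boundedI)
    then show ?thesis
      using f seg unfolding L2_bdry_def by (intro integrable_L2_inner[OF I]) auto
  qed
  show ?thesis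
    unfolding bdry_int_def add_divide_distrib[symmetric] sum.distrib[symmetric]
    by (intro arg_cong[of _ _ "\<lambda>x. x / 2"] sum.cong refl)
      (auto simp: inner_add_right int v w distrib_left)
qed

lemma bdry_int_scale: "bdry_int \<Omega> (\<lambda>x. f x \<bullet> (c *\<^sub>R v) x) = c * bdry_int \<Omega> (\<lambda>x. f x \<bullet> v x)"
  unfolding bdry_int_def
  by (simp add: case_prod_unfold sum_distrib_left mult.left_commute)

lemma ess_bounded_M_h: "p \<in> M_h Tr \<Omega> \<Longrightarrow> ess_bounded (lebesgue_on \<Omega>) p"
  by (intro ess_bounded_continuous continuous_M_h)

lemma ess_bounded_divg: "v \<in> X_h Tr \<Omega> \<Longrightarrow> ess_bounded (lebesgue_on \<Omega>) (divg v)"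
  using ess_bounded_inner[OF ess_bounded_const ess_bounded_strain, of v "mat 1"]
  by (simp add: mat_1_inner trace_strain)

lemma subspace_Z: "subspace Z"
  by (intro subspace_Times subspace_V_h subspace_M_h)

lemma fields_linear:
  assumes "z \<in> Z" "w \<in> Z"
  shows "AE x in lebesgue_on \<Omega>. fields (z + w) x = fields z x + fields w x"
    and "AE x in lebesgue_on \<Omega>. fields (c *\<^sub>R z) x = c *\<^sub>R fields z x"
  using AE_cell_interiors assms
  by (auto elim!: eventually_mono simp: fields_def strain_X_h_linear grad_M_h_linear V_h_X_h)

lemma ess_bounded_fields: "z \<in> Z \<Longrightarrow> ess_bounded (lebesgue_on \<Omega>) (fields z)"
  by (auto simp: fields_def intro!: ess_bounded_Pair ess_bounded_strain ess_bounded_M_h ess_bounded_grad V_h_X_h)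

lemma fields_AE_zero:
  assumes "z \<in> Z" "AE x in lebesgue_on \<Omega>. fields z x = 0"
  shows "z = 0"
proof -
  obtain u \<xi> p where z: "z = (u, \<xi>, p)" "u \<in> V_h Tr \<Omega>" "\<xi> \<in> M_h Tr \<Omega>" "p \<in> M_h Tr \<Omega>"
    using assms(1) by auto
  have "AE x in lebesgue_on \<Omega>. strain u x = 0" "AE x in lebesgue_on \<Omega>. \<xi> x = 0"
      "AE x in lebesgue_on \<Omega>. p x = 0"
    using assms(2) by (auto elim!: eventually_mono simp: z fields_def zero_prod_def)
  then show ?thesis
    using V_h_strain_zero M_h_AE_zero z by (simp add: zero_prod_def)
qed

end

section \<open>One time step as a monotone field problem\<close>

text \<open>Isolates what the flux argument uses. \<open>y\<close> stands for the previous
  \<open>\<eta>\<close>, \<open>g\<close> for the gravity term including its density, and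
  \<open>c\<close> for the diffusion factor after the flow equation has been rescaled;
  \<open>coercive\<close> is the property for which the weight \<open>\<delta>\<close> is
  chosen.\<close>

locale mfem_data = triangulated_domain +
  fixes N :: "real^2^2 \<Rightarrow> real^2^2" and C L k1 k2 k3 \<delta> \<gamma> c K1 K2 :: real and \<theta> :: nat
    and g :: "real^2" and K :: "real^2 \<Rightarrow> real^2^2" and y :: "real^2 \<Rightarrow> real"
  assumes N_cont: "continuous_on UNIV N"
    and C: "C > 0" and N_mono: "\<And>e e'. transpose e = e \<Longrightarrow> transpose e' = e' \<Longrightarrow>
        C * (norm (e - e'))\<^sup>2 \<le> (N e - N e') \<bullet> (e - e')"
    and N_lip: "\<And>e e'. transpose e = e \<Longrightarrow> transpose e' = e' \<Longrightarrow> norm (N e - N e') \<le> L * norm (e - e')"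
    and \<gamma>: "\<gamma> > 0" and coercive: "\<And>s t. \<gamma> * (s\<^sup>2 + t\<^sup>2) \<le> k3 * s\<^sup>2
      - k1 * (if \<theta> = 0 then 0 else (t - k1 * s) / k2) * s + \<delta> * ((t - k1 * s) / k2) * t"
    and c: "c > 0" and K1: "K1 > 0" and K2: "K2 \<ge> 0"
    and K_meas: "K \<in> borel_measurable (lebesgue_on \<Omega>)"
    and K_lower: "\<And>x z. x \<in> \<Omega> \<Longrightarrow> K1 * (norm z)\<^sup>2 \<le> (K x *v z) \<bullet> z"
    and K_upper: "\<And>x z. x \<in> \<Omega> \<Longrightarrow> norm (K x *v z) \<le> K2 * norm z"
    and y: "y \<in> M_h Tr \<Omega>"
begin

abbreviation "a x \<equiv> flux N \<theta> k1 k2 k3 \<delta> c g (y x) (K x)"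

lemma ess_bounded_K: "ess_bounded (lebesgue_on \<Omega>) h \<Longrightarrow> ess_bounded (lebesgue_on \<Omega>) (\<lambda>x. K x *v h x)"
  using ess_bounded_matrix_vector_mult[OF K_meas _ K2] K_upper by simp

lemma ess_bounded_eta:
  assumes "\<xi> \<in> M_h Tr \<Omega>" "p \<in> M_h Tr \<Omega>"
  shows "ess_bounded (lebesgue_on \<Omega>) (\<lambda>x. (p x - k1 * \<xi> x) / k2)"
  unfolding divide_inverse
  by (intro ess_bounded_mult ess_bounded_diff ess_bounded_const ess_bounded_M_h assms)

lemma ess_bounded_eta_theta:
  assumes "\<xi> \<in> M_h Tr \<Omega>" "p \<in> M_h Tr \<Omega>"
  shows "ess_bounded (lebesgue_on \<Omega>) (\<lambda>x. if \<theta> = 0 then y x else (p x - k1 * \<xi> x) / k2)"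
  using ess_bounded_eta[OF assms] ess_bounded_M_h[OF y] by (cases "\<theta> = 0") simp_all

lemma ess_bounded_N: "u \<in> X_h Tr \<Omega> \<Longrightarrow> ess_bounded (lebesgue_on \<Omega>) (\<lambda>x. N (strain u x))"
  by (intro ess_bounded_continuous_compose[OF N_cont] ess_bounded_strain)

lemma ess_bounded_flux:
  assumes "z \<in> Z"
  shows "ess_bounded (lebesgue_on \<Omega>) (\<lambda>x. a x (fields z x))"
proof -
  obtain u \<xi> p where z: "z = (u, \<xi>, p)" "u \<in> V_h Tr \<Omega>" and m: "\<xi> \<in> M_h Tr \<Omega>" "p \<in> M_h Tr \<Omega>"
    using assms by auto
  note X = V_h_X_h[OF z(2)]
  show ?thesis
    unfolding flux_def fields_def z(1) prod.case trace_strain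
    by (intro ess_bounded_Pair ess_bounded_diff ess_bounded_add
      ess_bounded_N[OF X] ess_bounded_scaleR ess_bounded_const ess_bounded_M_h[OF m(1)]
      ess_bounded_M_h[OF y] ess_bounded_divg[OF X] ess_bounded_mult[OF ess_bounded_const]
      ess_bounded_eta[OF m] ess_bounded_eta_theta[OF m] ess_bounded_K ess_bounded_grad[OF m(2)])
qed

lemma unique_flux_solution:
  assumes l_add: "\<And>z w. \<lbrakk>z \<in> Z; w \<in> Z\<rbrakk> \<Longrightarrow> l (z + w) = l z + l w"
    and l_scale: "\<And>z r. z \<in> Z \<Longrightarrow> l (r *\<^sub>R z) = r * l z"
  shows "\<exists>!z. z \<in> Z \<and> (\<forall>w\<in>Z. (\<integral>x. a x (fields z x) \<bullet> fields w x \<partial>lebesgue_on \<Omega>) = l w)"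
proof -
  obtain G where G: "finite G" "Z \<subseteq> span G"
    using finite_dim_discrete_space unfolding finite_dim_def by blast
  \<comment> \<open>Strains are symmetric, so the first slot is restricted to the matrices where
    \<open>N_mono\<close> and \<open>N_lip\<close> apply.\<close>
  let ?S = "{X :: (real^2^2) \<times> real \<times> real \<times> (real^2). transpose (fst X) = fst X}"
  show ?thesis
  proof (rule strongly_monotone_field_problem[where S = ?S])
    show "min C (min \<gamma> (c * K1)) > 0" using C \<gamma> c K1 by simp
    show "fields z x \<in> ?S" for z x
      by (simp add: fields_def case_prod_unfold transpose_strain)
    show "min C (min \<gamma> (c * K1)) * (norm (X - Y))\<^sup>2 \<le> (a x X - a x Y) \<bullet> (X - Y)"
      if "x \<in> space (lebesgue_on \<Omega>)" "X \<in> ?S" "Y \<in> ?S" for x X Y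
    proof -
      obtain e s t z e' s' t' z' where XY: "X = (e, s, t, z)" "Y = (e', s', t', z')"
        by (metis prod.collapse)
      show ?thesis
        unfolding XY using that XY c
        by (intro flux_mono N_mono coercive K_lower) auto
    qed
    show "norm (a x X - a x Y) \<le> (\<bar>L\<bar> + 2 * norm (mat 1 :: real^2^2) + \<bar>k3\<bar>
        + (\<bar>k1\<bar> + \<bar>\<delta>\<bar>) * (1 + \<bar>k1\<bar>) / \<bar>k2\<bar> + \<bar>c\<bar> * K2) * norm (X - Y)"
      if "x \<in> space (lebesgue_on \<Omega>)" "X \<in> ?S" "Y \<in> ?S" for x X Y
    proof -
      obtain e s t z e' s' t' z' where XY: "X = (e, s, t, z)" "Y = (e', s', t', z')"
        by (metis prod.collapse)
      show ?thesis
        unfolding XY using that XY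
        by (intro flux_lipschitz N_lip K_upper K2) auto
    qed
  qed (use G in \<open>simp_all add: finite_measure_domain subspace_Z ess_bounded_fields fields_linear
      fields_AE_zero ess_bounded_flux l_add l_scale del: mem_Sigma_iff\<close>)
qed

text \<open>The three parentheses are the momentum, constraint and flow equations, each with its own
  test function; the integral may be split because every term is integrable by itself.\<close>

lemma integral_flux_fields:
  assumes "u \<in> V_h Tr \<Omega>" "\<xi> \<in> M_h Tr \<Omega>" "p \<in> M_h Tr \<Omega>"
    and "v \<in> V_h Tr \<Omega>" "\<phi> \<in> M_h Tr \<Omega>" "\<psi> \<in> M_h Tr \<Omega>"
  shows "(\<integral>x. a x (fields (u, \<xi>, p) x) \<bullet> fields (v, \<phi>, \<psi>) x \<partial>lebesgue_on \<Omega>) =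
    (dom_int \<Omega> (\<lambda>x. N (strain u x) \<bullet> strain v x) - dom_int \<Omega> (\<lambda>x. \<xi> x * divg v x))
    + (k3 * dom_int \<Omega> (\<lambda>x. \<xi> x * \<phi> x) + dom_int \<Omega> (\<lambda>x. divg u x * \<phi> x)
       - k1 * dom_int \<Omega> (\<lambda>x. (if \<theta> = 0 then y x else (p x - k1 * \<xi> x) / k2) * \<phi> x))
    + (\<delta> * dom_int \<Omega> (\<lambda>x. ((p x - k1 * \<xi> x) / k2 - y x) * \<psi> x)
       + c * dom_int \<Omega> (\<lambda>x. (K x *v (grad p x - g)) \<bullet> grad \<psi> x))"
proof -
  let ?M = "lebesgue_on \<Omega>"
  note X = V_h_X_h[OF assms(1)] V_h_X_h[OF assms(4)]
  note b = ess_bounded_integrable[OF finite_measure_domain]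
  have 1: "integrable ?M (\<lambda>x. N (strain u x) \<bullet> strain v x)"
    by (intro b ess_bounded_inner ess_bounded_N ess_bounded_strain X)
  have 2: "integrable ?M (\<lambda>x. \<xi> x * divg v x)"
    by (intro b ess_bounded_mult ess_bounded_M_h ess_bounded_divg X assms)
  have 3: "integrable ?M (\<lambda>x. \<xi> x * \<phi> x)"
    by (intro b ess_bounded_mult ess_bounded_M_h assms)
  have 4: "integrable ?M (\<lambda>x. divg u x * \<phi> x)"
    by (intro b ess_bounded_mult ess_bounded_M_h ess_bounded_divg X assms)
  have 5: "integrable ?M (\<lambda>x. (if \<theta> = 0 then y x else (p x - k1 * \<xi> x) / k2) * \<phi> x)"
    by (intro b ess_bounded_mult ess_bounded_eta_theta ess_bounded_M_h assms)
  have 6: "integrable ?M (\<lambda>x. ((p x - k1 * \<xi> x) / k2 - y x) * \<psi> x)"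
    by (intro b ess_bounded_mult ess_bounded_diff ess_bounded_eta ess_bounded_M_h assms y)
  have 7: "integrable ?M (\<lambda>x. (K x *v (grad p x - g)) \<bullet> grad \<psi> x)"
    by (intro b ess_bounded_inner ess_bounded_K ess_bounded_diff ess_bounded_grad ess_bounded_const assms)
  have "a x (fields (u, \<xi>, p) x) \<bullet> fields (v, \<phi>, \<psi>) x =
      (N (strain u x) \<bullet> strain v x - \<xi> x * divg v x)
      + (k3 * (\<xi> x * \<phi> x) + divg u x * \<phi> x
         - k1 * ((if \<theta> = 0 then y x else (p x - k1 * \<xi> x) / k2) * \<phi> x))
      + (\<delta> * (((p x - k1 * \<xi> x) / k2 - y x) * \<psi> x)
         + c * ((K x *v (grad p x - g)) \<bullet> grad \<psi> x))" for x
    by (simp add: flux_def fields_def inner_diff_left mat_1_inner trace_strain distrib_right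
        left_diff_distrib mult.assoc)
  then show ?thesis
    unfolding dom_int_def using 1 2 3 4 5 6 7 by simp
qed

end

section \<open>Unique solvability\<close>

text \<open>The three test functions vary independently. Putting zero in two slots of the summed
  identity leaves one equation; conversely the three equations add up to the identity.\<close>

lemma (in mfem_data) flux_equation_iff:
  assumes u: "u \<in> V_h Tr \<Omega>" "\<xi> \<in> M_h Tr \<Omega>" "p \<in> M_h Tr \<Omega>"
    and FG: "F 0 = 0" "G 0 = 0"
  shows "(\<forall>w\<in>Z. (\<integral>x. a x (fields (u, \<xi>, p) x) \<bullet> fields w x \<partial>lebesgue_on \<Omega>)
        = F (fst w) + G (snd (snd w))) \<longleftrightarrow>
    (\<forall>v\<in>V_h Tr \<Omega>. dom_int \<Omega> (\<lambda>x. N (strain u x) \<bullet> strain v x) - dom_int \<Omega> (\<lambda>x. \<xi> x * divg v x) = F v)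
    \<and> (\<forall>\<phi>\<in>M_h Tr \<Omega>. k3 * dom_int \<Omega> (\<lambda>x. \<xi> x * \<phi> x) + dom_int \<Omega> (\<lambda>x. divg u x * \<phi> x)
       = k1 * dom_int \<Omega> (\<lambda>x. (if \<theta> = 0 then y x else (p x - k1 * \<xi> x) / k2) * \<phi> x))
    \<and> (\<forall>\<psi>\<in>M_h Tr \<Omega>. \<delta> * dom_int \<Omega> (\<lambda>x. ((p x - k1 * \<xi> x) / k2 - y x) * \<psi> x)
       + c * dom_int \<Omega> (\<lambda>x. (K x *v (grad p x - g)) \<bullet> grad \<psi> x) = G \<psi>)"
    (is "?L \<longleftrightarrow> (\<forall>v\<in>_. ?E1 v = F v) \<and> (\<forall>\<phi>\<in>_. ?E2 \<phi> = ?E2' \<phi>) \<and> (\<forall>\<psi>\<in>_. ?E3 \<psi> = G \<psi>)")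
proof -
  note int = integral_flux_fields[OF u]
  have zero: "0 \<in> V_h Tr \<Omega>" "0 \<in> M_h Tr \<Omega>"
    using subspace_0[OF subspace_V_h] subspace_0[OF subspace_M_h] by auto
  have divg0: "divg 0 x = 0" for x
    using trace_strain[of 0 x] by (simp add: strain_zero trace_def)
  have E0: "?E1 0 = 0" "?E2 0 = 0" "?E2' 0 = 0" "?E3 0 = 0"
    by (simp_all add: strain_zero divg0 grad_zero dom_int_def)
  show ?thesis
  proof
    assume L: ?L
    have eq: "?E1 v + (?E2 \<phi> - ?E2' \<phi>) + ?E3 \<psi> = F v + G \<psi>"
      if "v \<in> V_h Tr \<Omega>" "\<phi> \<in> M_h Tr \<Omega>" "\<psi> \<in> M_h Tr \<Omega>" for v \<phi> \<psi>
      using bspec[OF L, of "(v, \<phi>, \<psi>)"] int[OF that] that by simp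
    show "(\<forall>v\<in>V_h Tr \<Omega>. ?E1 v = F v) \<and> (\<forall>\<phi>\<in>M_h Tr \<Omega>. ?E2 \<phi> = ?E2' \<phi>) \<and> (\<forall>\<psi>\<in>M_h Tr \<Omega>. ?E3 \<psi> = G \<psi>)"
    proof (intro conjI ballI)
      show "?E1 v = F v" if "v \<in> V_h Tr \<Omega>" for v
        using eq[OF that zero(2) zero(2)] unfolding E0 FG by simp
      show "?E2 \<phi> = ?E2' \<phi>" if "\<phi> \<in> M_h Tr \<Omega>" for \<phi>
        using eq[OF zero(1) that zero(2)] unfolding E0 FG by simp
      show "?E3 \<psi> = G \<psi>" if "\<psi> \<in> M_h Tr \<Omega>" for \<psi>
        using eq[OF zero(1) zero(2) that] unfolding E0 FG by simp
    qed
  next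
    assume R: "(\<forall>v\<in>V_h Tr \<Omega>. ?E1 v = F v) \<and> (\<forall>\<phi>\<in>M_h Tr \<Omega>. ?E2 \<phi> = ?E2' \<phi>) \<and> (\<forall>\<psi>\<in>M_h Tr \<Omega>. ?E3 \<psi> = G \<psi>)"
    show ?L
    proof
      fix w assume "w \<in> Z"
      then obtain v \<phi> \<psi> where w: "w = (v, \<phi>, \<psi>)" "v \<in> V_h Tr \<Omega>" "\<phi> \<in> M_h Tr \<Omega>" "\<psi> \<in> M_h Tr \<Omega>"
        by auto
      show "(\<integral>x. a x (fields (u, \<xi>, p) x) \<bullet> fields w x \<partial>lebesgue_on \<Omega>) = F (fst w) + G (snd (snd w))"
        unfolding w(1) int[OF w(2-4)] fst_conv snd_conv using R w(2-4) by simp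
    qed
  qed
qed

theorem theorem3p4:
  fixes \<Omega> :: "(real^2) set" and Hs :: "real set" and Th :: "real \<Rightarrow> (real^2) set set"
    and lam \<mu> \<alpha> c0 \<mu>f \<rho>f \<kappa> k0 k1 a1 a2 a3 K1 K2 T :: real and \<Phi> :: "real \<Rightarrow> real"
    and g :: "real^2" and K :: "real^2 \<Rightarrow> real^2^2"
    and f f1 :: "real \<Rightarrow> real^2 \<Rightarrow> real^2" and \<phi> \<phi>1 :: "real^2 \<Rightarrow> real"
    and Nt n \<theta> :: nat and h :: real
    and un :: "real^2 \<Rightarrow> real^2" and \<xi>n \<eta>n :: "real^2 \<Rightarrow> real"
  assumes dom: "convex_polygonal_domain \<Omega>"
    and params: "lam > 0" "\<mu> > 0" "\<alpha> > 0" "c0 > 0" "\<mu>f > 0"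
    and kappa: "0 < k0" "k0 \<le> \<kappa>" "\<kappa> \<le> k1"
    and Phi_C2: "\<forall>r. \<Phi> differentiable at r" "\<forall>r. deriv \<Phi> differentiable at r"
                "continuous_on UNIV (deriv (deriv \<Phi>))"
    and Phi_bounds: "a1 > 0" "a2 > 0" "a3 > 0"
       "\<forall>r\<ge>0. a1 \<le> \<mu> * deriv \<Phi> r \<and> \<mu> * deriv \<Phi> r < \<kappa>"
       "\<forall>r\<ge>0. \<bar>r * deriv (deriv \<Phi>) r\<bar> \<le> a2"
       "\<forall>r\<ge>0. deriv \<Phi> r + 2 * r * deriv (deriv \<Phi>) r \<ge> a3"
    and N_mono: "\<exists>C>0. \<forall>e1 e2. transpose e1 = e1 \<longrightarrow> transpose e2 = e2 \<longrightarrow>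
        (N_op lam \<kappa> \<mu> \<Phi> e1 - N_op lam \<kappa> \<mu> \<Phi> e2) \<bullet> (e1 - e2) \<ge> C * (norm (e1 - e2))\<^sup>2"
    and N_lip: "\<exists>L. \<forall>e1 e2. transpose e1 = e1 \<longrightarrow> transpose e2 = e2 \<longrightarrow>
        norm (N_op lam \<kappa> \<mu> \<Phi> e1 - N_op lam \<kappa> \<mu> \<Phi> e2) \<le> L * norm (e1 - e2)"
    and K_meas: "K \<in> borel_measurable (lebesgue_on \<Omega>)"
    and K_spd: "0 < K1" "K1 \<le> K2"
       "\<forall>x\<in>\<Omega>. transpose (K x) = K x \<and>
          (\<forall>\<zeta>. K1 * (norm \<zeta>)\<^sup>2 \<le> (K x *v \<zeta>) \<bullet> \<zeta> \<and> (K x *v \<zeta>) \<bullet> \<zeta> \<le> K2 * (norm \<zeta>)\<^sup>2)"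
    and data: "\<forall>t\<in>{0..T}. L2_dom \<Omega> (f t)" "\<forall>t\<in>{0..T}. L2_bdry \<Omega> (f1 t)"
       "L2_dom \<Omega> \<phi>" "L2_bdry \<Omega> \<phi>1"
    and time: "T > 0" "Nt \<ge> 1" "n < Nt"
    and theta: "\<theta> \<in> {0, 1}"
    and mesh: "quasi_uniform_family Hs Th (closure \<Omega>)" "h \<in> Hs"
    and prev: "un \<in> V_h (Th h) \<Omega>" "\<xi>n \<in> M_h (Th h) \<Omega>" "\<eta>n \<in> M_h (Th h) \<Omega>"
  shows "\<exists>!(u, \<xi>, \<eta>). u \<in> V_h (Th h) \<Omega> \<and> \<xi> \<in> M_h (Th h) \<Omega> \<and> \<eta> \<in> M_h (Th h) \<Omega> \<and>
           mfem_step (Th h) \<Omega> lam \<kappa> \<mu> \<Phi> \<alpha> c0 \<mu>f \<rho>f g K f f1 \<phi> \<phi>1 \<theta>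
             (T / real Nt) (real (Suc n) * (T / real Nt)) \<eta>n u \<xi> \<eta>"
proof -
  define Tr where "Tr = Th h"
  have "conforming_triangulation Tr (closure \<Omega>)"
    using mesh unfolding quasi_uniform_family_def Tr_def by blast
  then interpret triangulated_domain \<Omega> Tr by unfold_locales (rule dom)
  \<comment> \<open>The coefficients of the scheme get new letters because \<open>k1\<close> already
    denotes the upper bound of \<open>\<kappa>\<close>.\<close>
  define q1 q2 q3 dt t where q: "q1 = kappa1 lam \<alpha> c0" "q2 = kappa2 lam \<alpha> c0" "q3 = kappa3 lam \<alpha> c0"
    and dt: "dt = T / real Nt" and t: "t = real (Suc n) * (T / real Nt)"
  have "lam * \<alpha>\<^sup>2 + c0 > 0" using params by (simp add: add_pos_pos)
  then have pos: "q1 > 0" "q2 > 0" "q3 > 0"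
    using params by (simp_all add: q kappa1_def kappa2_def kappa3_def)
  obtain \<delta> \<gamma> where \<delta>: "\<delta> > 0" and \<gamma>: "\<gamma> > 0" and coercive: "\<And>s t. \<gamma> * (s\<^sup>2 + t\<^sup>2) \<le>
      q3 * s\<^sup>2 - q1 * (if \<theta> = 0 then 0 else (t - q1 * s) / q2) * s + \<delta> * ((t - q1 * s) / q2) * t"
    using coupling_coercive[OF pos, of \<theta>] by blast
  have dt0: "dt > 0" using time by (simp add: dt)
  \<comment> \<open>Multiplying the flow equation by \<open>\<delta> * dt\<close> clears the time
    step from the difference quotient and leaves this factor at the diffusion term.\<close>
  define c where "c = \<delta> * dt / \<mu>f"
  have c: "c > 0" using \<delta> dt0 params by (simp add: c_def)
  obtain C where C: "C > 0" "\<And>e e'. transpose e = e \<Longrightarrow> transpose e' = e' \<Longrightarrow>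
      C * (norm (e - e'))\<^sup>2 \<le> (N_op lam \<kappa> \<mu> \<Phi> e - N_op lam \<kappa> \<mu> \<Phi> e') \<bullet> (e - e')"
    using N_mono by blast
  obtain L where L: "\<And>e e'. transpose e = e \<Longrightarrow> transpose e' = e' \<Longrightarrow>
      norm (N_op lam \<kappa> \<mu> \<Phi> e - N_op lam \<kappa> \<mu> \<Phi> e') \<le> L * norm (e - e')"
    using N_lip by blast
  have K2: "K2 \<ge> 0" using K_spd by linarith
  have K_lower: "K1 * (norm z)\<^sup>2 \<le> (K x *v z) \<bullet> z" if "x \<in> \<Omega>" for x z
    using K_spd(3) that by blast
  have K_upper: "norm (K x *v z) \<le> K2 * norm z" if "x \<in> \<Omega>" for x z
  proof (rule symmetric_form_norm_bound)
    show "transpose (K x) = K x" and "(K x *v z) \<bullet> z \<le> K2 * (norm z)\<^sup>2" for z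
      using K_spd(3) that by auto
    have "0 \<le> K1 * (norm z)\<^sup>2" for z :: "real^2" using K_spd(1) by simp
    then show "0 \<le> (K x *v z) \<bullet> z" for z using K_lower[OF that] order_trans by blast
  qed
  interpret mfem_data \<Omega> Tr "N_op lam \<kappa> \<mu> \<Phi>" C L q1 q2 q3 \<delta> \<gamma> c K1 K2 \<theta> "\<rho>f *\<^sub>R g" K \<eta>n
    using prev(3) unfolding Tr_def[symmetric]
    by unfold_locales (intro continuous_N_op Phi_C2 C L \<gamma> coercive c K_spd K2 K_meas K_lower K_upper; assumption)+

  \<comment> \<open>The loads are square integrable for times in \<open>{0..T}\<close>, and
    \<open>n < Nt\<close> keeps the new time level within it.\<close>
  have "t \<in> {0..T}"
  proof -
    have "real (Suc n) \<le> real Nt" using time by simp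
    then have "real (Suc n) * (T / real Nt) \<le> real Nt * (T / real Nt)"
      using time by (intro mult_right_mono) auto
    then show ?thesis using time by (simp add: t)
  qed
  then have f: "L2_dom \<Omega> (f t)" "L2_bdry \<Omega> (f1 t)" using data by auto
  define F where "F v = dom_int \<Omega> (\<lambda>x. f t x \<bullet> v x) + bdry_int \<Omega> (\<lambda>x. f1 t x \<bullet> v x)" for v
  define G where "G \<psi> = dom_int \<Omega> (\<lambda>x. \<phi> x * \<psi> x) + bdry_int \<Omega> (\<lambda>x. \<phi>1 x * \<psi> x)" for \<psi>
  have F: "F (v + w) = F v + F w" "F (r *\<^sub>R v) = r * F v"
    if "v \<in> V_h Tr \<Omega>" "w \<in> V_h Tr \<Omega>" for v w r
    using that f unfolding F_def
    by (simp_all only: dom_int_L2_add bdry_int_L2_add dom_int_scale bdry_int_scale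
        continuous_X_h V_h_X_h algebra_simps)
  \<comment> \<open>On the reals the inner product is multiplication, so the additivity lemmas for
    vector data also cover the scalar source terms.\<close>
  have G_inner: "G \<psi> = dom_int \<Omega> (\<lambda>x. \<phi> x \<bullet> \<psi> x) + bdry_int \<Omega> (\<lambda>x. \<phi>1 x \<bullet> \<psi> x)" for \<psi>
    by (simp add: G_def)
  have G: "G (v + w) = G v + G w" "G (r *\<^sub>R v) = r * G v"
    if "v \<in> M_h Tr \<Omega>" "w \<in> M_h Tr \<Omega>" for v w r
    using that data(3,4) unfolding G_inner
    by (simp_all only: dom_int_L2_add bdry_int_L2_add dom_int_scale bdry_int_scale
        continuous_M_h algebra_simps)
  \<comment> \<open>The middle slot carries no load: the previous \<open>\<eta>\<close> in the
    constraint equation is part of the flux.\<close>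
  define l where "l w = F (fst w) + \<delta> * dt * G (snd (snd w))"
    for w :: "(real^2 \<Rightarrow> real^2) \<times> (real^2 \<Rightarrow> real) \<times> (real^2 \<Rightarrow> real)"
  define solves where "solves z \<longleftrightarrow>
    (\<forall>w\<in>Z. (\<integral>x. a x (fields z x) \<bullet> fields w x \<partial>lebesgue_on \<Omega>) = l w)" for z
  have "\<exists>!z. z \<in> Z \<and> solves z"
    unfolding solves_def by (rule unique_flux_solution) (auto simp: l_def F G algebra_simps)
  then obtain z where z: "z \<in> Z \<and> solves z"
    and uniq: "\<forall>z'. z' \<in> Z \<and> solves z' \<longrightarrow> z' = z"
    by (rule ex1E)
  let ?step = "mfem_step Tr \<Omega> lam \<kappa> \<mu> \<Phi> \<alpha> c0 \<mu>f \<rho>f g K f f1 \<phi> \<phi>1 \<theta> dt t \<eta>n"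
  have step_iff: "?step u \<xi> \<eta> \<longleftrightarrow> solves (u, \<xi>, p)"
    if u: "u \<in> V_h Tr \<Omega>" "\<xi> \<in> M_h Tr \<Omega>" "p \<in> M_h Tr \<Omega>"
      and p: "p = (\<lambda>y. q1 * \<xi> y + q2 * \<eta> y)" for u \<xi> \<eta> p
  proof -
    have zero: "F 0 = 0" "\<delta> * dt * G 0 = 0"
      by (simp_all add: F_def G_def dom_int_def bdry_int_def case_prod_unfold)
    have \<eta>: "(p x - q1 * \<xi> x) / q2 = \<eta> x" for x using pos by (simp add: p)
    \<comment> \<open>The flow equation is equivalent to its multiple by the positive number
      \<open>\<delta> * dt\<close>; \<open>I\<close> stands for the diffusion integral.\<close>
    have "\<delta> * dom_int \<Omega> (\<lambda>x. (\<eta> x - \<eta>n x) * \<psi> x) + c * I = \<delta> * dt * G \<psi> \<longleftrightarrow>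
        dom_int \<Omega> (\<lambda>x. ((\<eta> x - \<eta>n x) / dt) * \<psi> x) + (1 / \<mu>f) * I = G \<psi>" for \<psi> I
    proof -
      have "dom_int \<Omega> (\<lambda>x. ((\<eta> x - \<eta>n x) / dt) * \<psi> x) = dom_int \<Omega> (\<lambda>x. (\<eta> x - \<eta>n x) * \<psi> x) / dt"
        by (simp add: dom_int_def)
      then have "\<delta> * dom_int \<Omega> (\<lambda>x. (\<eta> x - \<eta>n x) * \<psi> x) + c * I = (\<delta> * dt) *
          (dom_int \<Omega> (\<lambda>x. ((\<eta> x - \<eta>n x) / dt) * \<psi> x) + (1 / \<mu>f) * I)"
        using dt0 by (simp add: c_def distrib_left)
      then show ?thesis using \<delta> dt0 by simp
    qed
    moreover have "(if \<theta> = 0 then \<eta>n x else \<eta> x) = (if \<theta> = 0 then \<eta>n else \<eta>) x" for x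
      by simp
    ultimately show ?thesis
      unfolding solves_def l_def flux_equation_iff[OF u, of F "\<lambda>\<psi>. \<delta> * dt * G \<psi>", OF zero]
      unfolding \<eta> mfem_step_def Let_def q[symmetric] p[symmetric]
      by (simp only: F_def G_def)
  qed
  obtain u \<xi> p where zu: "z = (u, \<xi>, p)" and u: "u \<in> V_h Tr \<Omega>" "\<xi> \<in> M_h Tr \<Omega>" "p \<in> M_h Tr \<Omega>"
    using z by auto
  \<comment> \<open>Inverts \<open>p = q1 * \<xi> + q2 * \<eta>\<close>; the result stays discrete
    since \<open>p\<close> and \<open>\<xi>\<close> lie in the same space.\<close>
  define \<eta> where "\<eta> = (1 / q2) *\<^sub>R (p - q1 *\<^sub>R \<xi>)"
  have \<eta>: "\<eta> \<in> M_h Tr \<Omega>"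
    unfolding \<eta>_def by (intro subspace_scale subspace_diff subspace_M_h u)
  have p: "p = (\<lambda>y. q1 * \<xi> y + q2 * \<eta> y)" using pos by (auto simp: \<eta>_def)
  have "\<exists>!(u, \<xi>, \<eta>). u \<in> V_h Tr \<Omega> \<and> \<xi> \<in> M_h Tr \<Omega> \<and> \<eta> \<in> M_h Tr \<Omega> \<and> ?step u \<xi> \<eta>"
  proof (rule ex1I[of _ "(u, \<xi>, \<eta>)"])
    show "case (u, \<xi>, \<eta>) of (u, \<xi>, \<eta>) \<Rightarrow>
        u \<in> V_h Tr \<Omega> \<and> \<xi> \<in> M_h Tr \<Omega> \<and> \<eta> \<in> M_h Tr \<Omega> \<and> ?step u \<xi> \<eta>"
      using z u \<eta> step_iff[OF u p] by (simp add: zu)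
    fix s
    assume s: "case s of (u, \<xi>, \<eta>) \<Rightarrow>
        u \<in> V_h Tr \<Omega> \<and> \<xi> \<in> M_h Tr \<Omega> \<and> \<eta> \<in> M_h Tr \<Omega> \<and> ?step u \<xi> \<eta>"
    obtain u' \<xi>' \<eta>' where s': "s = (u', \<xi>', \<eta>')" by (cases s) auto
    then have u': "u' \<in> V_h Tr \<Omega>" "\<xi>' \<in> M_h Tr \<Omega>" "\<eta>' \<in> M_h Tr \<Omega>" "?step u' \<xi>' \<eta>'"
      using s by simp_all
    \<comment> \<open>A competing solution is carried to the unknown \<open>p'\<close>, where
      \<open>uniq\<close> applies; cancelling \<open>q2\<close> afterwards returns equality of the
      \<open>\<eta>\<close> components.\<close>
    define p' where "p' = q1 *\<^sub>R \<xi>' + q2 *\<^sub>R \<eta>'"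
    have p': "p' \<in> M_h Tr \<Omega>"
      unfolding p'_def by (intro subspace_add subspace_scale subspace_M_h u')
    have p'_eq: "p' = (\<lambda>y. q1 * \<xi>' y + q2 * \<eta>' y)" by (auto simp: p'_def)
    have "(u', \<xi>', p') = z"
      using step_iff[OF u'(1,2) p' p'_eq] u' p' by (intro uniq[rule_format]) simp
    then have eq: "u' = u" "\<xi>' = \<xi>" "p' = p" by (auto simp: zu)
    have "\<eta>' x = \<eta> x" for x
    proof -
      have "q1 * \<xi> x + q2 * \<eta>' x = q1 * \<xi> x + q2 * \<eta> x"
        using p p'_eq eq by metis
      then show ?thesis using pos by simp
    qed
    then show "s = (u, \<xi>, \<eta>)" by (auto simp: s' eq)
  qed
  then show ?thesis by (simp only: Tr_def dt t)
qed

end
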